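(* Let $\psi:\mathbb{N}\to(0,1]$, let $\underline{\tau}_\psi=\liminf_{q\to\infty}\frac{-\log\psi(q)}{\log q}$, $s=\frac{1}{1+\underline{\tau}_\psi}$, and $\theta_s:\mathbb{N}\to\mathbb{R}^+$, $\theta_s(q)=q^{1-s}\psi(q)^s$. Suppose $\underline{\tau}_\psi>1$, $\theta_s$ is non-increasing, and \[ \sum_{q=1}^\infty\Big(\frac{\psi(q)}{q}\Big)^s\log q=+\infty. \] Then $\dim_H L(\psi)=\frac{1}{1+\underline{\tau}_\psi}$.
   Context: Every $x\in(0,1]$ has a unique Lüroth expansion $x=\sum_{k=1}^\infty \frac{1}{d_k\prod_{j=1}^{k-1}d_j(d_j-1)}$ with digits $d_k=d_k(x)\in\{2,3,4,\dots\}$. For $n\in\mathbb{N}$ define $Q_n(x)=d_n\prod_{j=1}^{n-1}d_j(d_j-1)$ (empty product $=1$) and $P_n(x)=Q_n(x)\sum_{k=1}^n \frac{1}{d_k\prod_{j=1}^{k-1}d_j(d_j-1)}$. For $\psi:\mathbb{N}\to(0,1]$, \[ L(\psi)=\limsup_{n\to\infty}\Big\{x\in(0,1]: \Big|x-\frac{P_n(x)}{Q_n(x)}\Big|<\frac{\psi(Q_n(x))}{Q_n(x)}\Big\}, \] the set of $x$ for which the inequality holds for infinitely many $n$. $\dim_H$ is Hausdorff dimension. *)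

theory Defs
  imports "HOL-Analysis.Analysis"
begin

section \<open>Hausdorff measure and Hausdorff dimension\<close>

(* The t-th power of the diameter of a bounded set, with the usual conventions
   |{}|^t = 0 for all t, and |U|^0 = 1 for U nonempty (whereas 0 powr 0 = 0). *)
definition diam_power :: "real \<Rightarrow> 'a::metric_space set \<Rightarrow> real" where
  "diam_power t U = (if U = {} then 0 else if t = 0 then 1 else diameter U powr t)"

(* Boundedness is required because the library's diameter is a real number, which is
   meaningless for unbounded sets. Finite covers are included, since U i may be empty. *)
definition delta_covers :: "real \<Rightarrow> 'a::metric_space set \<Rightarrow> (nat \<Rightarrow> 'a set) set" where
  "delta_covers \<delta> A = {U. A \<subseteq> (\<Union>i. U i) \<and> (\<forall>i. bounded (U i) \<and> diameter (U i) \<le> \<delta>)}"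

definition hausdorff_premeasure :: "real \<Rightarrow> real \<Rightarrow> 'a::metric_space set \<Rightarrow> ennreal" where
  "hausdorff_premeasure t \<delta> A = (INF U\<in>delta_covers \<delta> A. \<Sum>i. ennreal (diam_power t (U i)))"

definition hausdorff_measure :: "real \<Rightarrow> 'a::metric_space set \<Rightarrow> ennreal" where
  "hausdorff_measure t A = (SUP \<delta>\<in>{0<..}. hausdorff_premeasure t \<delta> A)"

definition hausdorff_dim :: "'a::metric_space set \<Rightarrow> ereal" where
  "hausdorff_dim A = Inf (ereal ` {t. 0 \<le> t \<and> hausdorff_measure t A = 0})"

section \<open>Lueroth expansions\<close>

(* Digit sequences are indexed from 1. *)
definition luroth_denom :: "(nat \<Rightarrow> nat) \<Rightarrow> nat \<Rightarrow> nat" where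
  "luroth_denom d n = d n * (\<Prod>j = 1..<n. d j * (d j - 1))"

(* The unused entry d 0 is fixed to be 0, so that the expansion is unique as a function. *)
definition is_luroth_expansion :: "(nat \<Rightarrow> nat) \<Rightarrow> real \<Rightarrow> bool" where
  "is_luroth_expansion d x \<longleftrightarrow>
     d 0 = 0 \<and> (\<forall>k\<ge>1. 2 \<le> d k) \<and> (\<lambda>k. 1 / real (luroth_denom d (Suc k))) sums x"

definition luroth_digits :: "real \<Rightarrow> nat \<Rightarrow> nat" where
  "luroth_digits x = (THE d. is_luroth_expansion d x)"

definition luroth_Q :: "nat \<Rightarrow> real \<Rightarrow> nat" where
  "luroth_Q n x = luroth_denom (luroth_digits x) n"

definition luroth_P :: "nat \<Rightarrow> real \<Rightarrow> real" where
  "luroth_P n x = real (luroth_Q n x) * (\<Sum>k = 1..n. 1 / real (luroth_denom (luroth_digits x) k))"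

definition luroth_L :: "(nat \<Rightarrow> real) \<Rightarrow> real set" where
  "luroth_L \<psi> = limsup (\<lambda>n. {x \<in> {0<..1}.
     \<bar>x - luroth_P n x / real (luroth_Q n x)\<bar> < \<psi> (luroth_Q n x) / real (luroth_Q n x)})"

subsection \<open>Existence and uniqueness of the expansion\<close>

lemma luroth_denom_Suc_shift:
  "luroth_denom d (Suc (Suc k)) = d 1 * (d 1 - 1) * luroth_denom (d \<circ> Suc) (Suc k)"
proof -
  have "(\<Prod>j = 1..<Suc (Suc k). d j * (d j - 1))
      = d 1 * (d 1 - 1) * (\<Prod>j = Suc 1..<Suc (Suc k). d j * (d j - 1))"
    by (subst prod.atLeast_Suc_lessThan) auto
  also have "(\<Prod>j = Suc 1..<Suc (Suc k). d j * (d j - 1))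
      = (\<Prod>j = 1..<Suc k. d (Suc j) * (d (Suc j) - 1))"
    by (rule prod.shift_bounds_Suc_ivl)
  finally show ?thesis
    by (simp add: luroth_denom_def)
qed

lemma luroth_remainder_step:
  fixes e :: nat and p y :: real
  assumes "2 \<le> e" "0 < p"
  shows "1 / (real e * p) + y / (p * (real e * real (e - 1)))
       = (1 / real e + y / (real e * real (e - 1))) / p"
  using assms by (simp add: field_simps)

lemma luroth_sum_bounds:
  assumes d: "\<And>k. 1 \<le> k \<Longrightarrow> 2 \<le> d k"
    and sm: "(\<lambda>k. 1 / real (luroth_denom d (Suc k))) sums x"
  shows "0 < x" "x \<le> 1"
proof -
  let ?t = "\<lambda>k. 1 / real (luroth_denom d (Suc k))"
  let ?p = "\<lambda>n. \<Prod>j = 1..<Suc n. d j * (d j - 1)"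
  have pos: "0 < ?p n" for n
    using d by (intro prod_pos) (auto, fastforce+)
  have tpos: "0 < ?t n" for n
    using pos[of n] d[of "Suc n"] unfolding luroth_denom_def by simp
  show "0 < x"
    using suminf_pos[of ?t] sm tpos by (auto simp: sums_iff)
  have step: "(\<Sum>k<n. ?t k) + 1 / real (?p n) \<le> 1" for n
  proof (induction n)
    case 0
    then show ?case by simp
  next
    case (Suc n)
    define e where "e = d (Suc n)"
    have e: "2 \<le> e" using d by (simp add: e_def)
    have "?t n + 1 / real (?p (Suc n))
        = 1 / (real e * real (?p n)) + 1 / (real (?p n) * (real e * real (e - 1)))"
      by (simp add: luroth_denom_def e_def)
    also have "\<dots> = (1 / real e + 1 / (real e * real (e - 1))) / real (?p n)"
      using e pos[of n] by (intro luroth_remainder_step) simp_all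
    also have "1 / real e + 1 / (real e * real (e - 1)) = 1 / real (e - 1)"
      using e by (simp add: of_nat_diff divide_simps)
    also have "\<dots> / real (?p n) \<le> 1 / real (?p n)"
      using e pos[of n] by (intro divide_right_mono) (auto simp: divide_simps)
    finally show ?case using Suc by simp
  qed
  have part: "(\<Sum>k<n. ?t k) \<le> 1" for n
    using step[of n] by (smt (verit) of_nat_0_le_iff divide_nonneg_nonneg)
  show "x \<le> 1"
    using sm part unfolding sums_def by (intro LIMSEQ_le_const2[of _ x]) auto
qed

lemma luroth_sum_decomp:
  assumes d: "\<And>k. 1 \<le> k \<Longrightarrow> 2 \<le> d k"
    and sm: "(\<lambda>k. 1 / real (luroth_denom d (Suc k))) sums x"
  obtains y where "(\<lambda>k. 1 / real (luroth_denom (d \<circ> Suc) (Suc k))) sums y"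
    "x = 1 / real (d 1) + y / (real (d 1) * real (d 1 - 1))"
proof -
  let ?t = "\<lambda>k. 1 / real (luroth_denom d (Suc k))"
  let ?c = "real (d 1) * real (d 1 - 1)"
  have c: "?c \<noteq> 0" using d[of 1] by simp
  have t0: "?t 0 = 1 / real (d 1)" by (simp add: luroth_denom_def)
  have "(\<lambda>k. ?t (Suc k)) sums (x - ?t 0)"
    using sm by (subst sums_Suc_iff) simp
  then have "(\<lambda>k. ?c * ?t (Suc k)) sums (?c * (x - ?t 0))"
    by (rule sums_mult)
  moreover have "?c * ?t (Suc k) = 1 / real (luroth_denom (d \<circ> Suc) (Suc k))" for k
    unfolding luroth_denom_Suc_shift using c by simp
  ultimately have "(\<lambda>k. 1 / real (luroth_denom (d \<circ> Suc) (Suc k))) sums (?c * (x - ?t 0))"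
    by simp
  moreover have "x = 1 / real (d 1) + ?c * (x - ?t 0) / ?c"
    using c t0 by simp
  ultimately show ?thesis using that by blast
qed

lemma luroth_first_digit:
  assumes "2 \<le> (m::nat)" "0 < y" "y \<le> 1" "x = 1 / real m + y / (real m * real (m - 1))"
  shows "1 / real m < x" "x \<le> 1 / real (m - 1)"
proof -
  show "1 / real m < x" using assms by simp
  have "x \<le> 1 / real m + 1 / (real m * real (m - 1))"
    unfolding assms(4) using assms by (intro add_left_mono divide_right_mono) auto
  also have "\<dots> = 1 / real (m - 1)"
    using assms(1) by (simp add: of_nat_diff divide_simps)
  finally show "x \<le> 1 / real (m - 1)" .
qed

lemma luroth_first_digit_unique:
  assumes "2 \<le> (m::nat)" "1 / real m < x" "x \<le> 1 / real (m - 1)"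
    "2 \<le> (n::nat)" "1 / real n < x" "x \<le> 1 / real (n - 1)"
  shows "m = n"
proof -
  have "1 / real m < 1 / real (n - 1)" "1 / real n < 1 / real (m - 1)"
    using assms by linarith+
  then have "real (n - 1) < real m" "real (m - 1) < real n"
    using assms(1,4) by (auto simp: divide_simps)
  then show ?thesis using assms(1,4) by linarith
qed

lemma luroth_digits_eq:
  assumes "\<And>k. 1 \<le> k \<Longrightarrow> 2 \<le> d k" "(\<lambda>k. 1 / real (luroth_denom d (Suc k))) sums x"
    "\<And>k. 1 \<le> k \<Longrightarrow> 2 \<le> d' k" "(\<lambda>k. 1 / real (luroth_denom d' (Suc k))) sums x"
  shows "d (Suc n) = d' (Suc n)"
  using assms
proof (induction n arbitrary: d d' x)
  case (0 d d' x)
  obtain y where y: "(\<lambda>k. 1 / real (luroth_denom (d \<circ> Suc) (Suc k))) sums y"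
    "x = 1 / real (d 1) + y / (real (d 1) * real (d 1 - 1))"
    using luroth_sum_decomp[OF 0(1,2)] by blast
  obtain y' where y': "(\<lambda>k. 1 / real (luroth_denom (d' \<circ> Suc) (Suc k))) sums y'"
    "x = 1 / real (d' 1) + y' / (real (d' 1) * real (d' 1 - 1))"
    using luroth_sum_decomp[OF 0(3,4)] by blast
  have "0 < y" "y \<le> 1" "0 < y'" "y' \<le> 1"
    using luroth_sum_bounds[OF _ y(1)] luroth_sum_bounds[OF _ y'(1)] 0 by auto
  then have "d 1 = d' 1"
    using 0(1)[of 1] 0(3)[of 1] luroth_first_digit[OF _ _ _ y(2)] luroth_first_digit[OF _ _ _ y'(2)]
    by (intro luroth_first_digit_unique[of _ x]) simp_all
  then show ?case by simp
next
  case (Suc n d d' x)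
  obtain y where y: "(\<lambda>k. 1 / real (luroth_denom (d \<circ> Suc) (Suc k))) sums y"
    "x = 1 / real (d 1) + y / (real (d 1) * real (d 1 - 1))"
    using luroth_sum_decomp[OF Suc.prems(1,2)] by blast
  obtain y' where y': "(\<lambda>k. 1 / real (luroth_denom (d' \<circ> Suc) (Suc k))) sums y'"
    "x = 1 / real (d' 1) + y' / (real (d' 1) * real (d' 1 - 1))"
    using luroth_sum_decomp[OF Suc.prems(3,4)] by blast
  have b: "0 < y" "y \<le> 1" "0 < y'" "y' \<le> 1"
    using luroth_sum_bounds[OF _ y(1)] luroth_sum_bounds[OF _ y'(1)] Suc.prems by auto
  then have eq: "d 1 = d' 1"
    using Suc.prems(1)[of 1] Suc.prems(3)[of 1]
      luroth_first_digit[OF _ _ _ y(2)] luroth_first_digit[OF _ _ _ y'(2)]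
    by (intro luroth_first_digit_unique[of _ x]) simp_all
  have "y = y'"
    using y(2) y'(2) eq Suc.prems(3)[of 1] by simp
  then have "(d \<circ> Suc) (Suc n) = (d' \<circ> Suc) (Suc n)"
    using y(1) y'(1) Suc.prems(1,3) by (intro Suc.IH[of _ y]) (simp_all del: o_apply, simp_all)
  then show ?case by simp
qed

lemma luroth_step_exists:
  assumes "0 < x" "x \<le> (1::real)"
  shows "\<exists>(m::nat) y. 2 \<le> m \<and> 0 < y \<and> y \<le> 1 \<and> x = 1 / real m + y / (real m * real (m - 1))"
proof -
  define k where "k = nat \<lfloor>1 / x\<rfloor>"
  have k: "1 \<le> k" "real k \<le> 1 / x" "1 / x < real k + 1"
    using assms unfolding k_def by (auto simp: le_nat_iff le_floor_iff)
  define y where "y = (x - 1 / real (Suc k)) * (real (Suc k) * real k)"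
  have x: "1 / real (Suc k) < x" "x \<le> 1 / real k"
    using k assms by (auto simp: field_simps)
  have "0 < y" using x(1) k(1) unfolding y_def by simp
  have "y \<le> (1 / real k - 1 / real (Suc k)) * (real (Suc k) * real k)"
    using x(2) unfolding y_def by (intro mult_right_mono) auto
  also have "\<dots> = 1" using k(1) by (simp add: divide_simps del: of_nat_Suc)
  finally have "y \<le> 1" .
  moreover have "x = 1 / real (Suc k) + y / (real (Suc k) * real (Suc k - 1))"
    using k(1) unfolding y_def by simp
  ultimately show ?thesis using k(1) \<open>0 < y\<close> by (intro exI[of _ "Suc k"] exI[of _ y]) auto
qed

theorem luroth_expansion_unique:
  assumes "0 < x" "x \<le> 1"
  shows "\<exists>!d. is_luroth_expansion d x"
proof -
  have "\<forall>x\<in>{0<..1::real}. \<exists>m. \<exists>y. 2 \<le> (m::nat) \<and> 0 < y \<and> y \<le> 1 \<and>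
      x = 1 / real m + y / (real m * real (m - 1))"
    using luroth_step_exists by auto
  then obtain D T where DT: "\<And>x. x \<in> {0<..1::real} \<Longrightarrow> 2 \<le> (D x::nat) \<and> 0 < T x \<and> T x \<le> 1 \<and>
      x = 1 / real (D x) + T x / (real (D x) * real (D x - 1))"
    by metis
  define z where "z n = (T ^^ n) x" for n
  have z: "z n \<in> {0<..1}" for n
    using DT assms by (induction n) (auto simp: z_def)
  define d where "d n = (if n = 0 then 0 else D (z (n - 1)))" for n
  have d2: "2 \<le> d k" if "1 \<le> k" for k
    using DT z that by (auto simp: d_def)
  let ?t = "\<lambda>k. 1 / real (luroth_denom d (Suc k))"
  let ?p = "\<lambda>n. \<Prod>j = 1..<Suc n. d j * (d j - 1)"
  have p2: "2 ^ n \<le> ?p n" for n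
  proof (induction n)
    case (Suc n)
    have "2 * 1 \<le> d (Suc n) * (d (Suc n) - 1)"
      using d2[of "Suc n"] by (intro mult_mono) auto
    then have "2 ^ n * 2 \<le> ?p n * (d (Suc n) * (d (Suc n) - 1))"
      using Suc by (intro mult_mono) auto
    then show ?case by (simp add: mult.commute)
  qed simp
  have pos: "0 < ?p n" for n
    using p2[of n] by (smt (verit) zero_less_numeral zero_less_power order_less_le_trans)
  have rem: "x = (\<Sum>k<n. ?t k) + z n / real (?p n)" for n
  proof (induction n)
    case 0
    then show ?case by (simp add: z_def)
  next
    case (Suc n)
    define e where "e = d (Suc n)"
    have eD: "e = D (z n)" by (simp add: e_def d_def)
    have e: "2 \<le> e" using d2 by (simp add: e_def)
    have "?t n + z (Suc n) / real (?p (Suc n))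
        = 1 / (real e * real (?p n)) + z (Suc n) / (real (?p n) * (real e * real (e - 1)))"
      by (simp add: luroth_denom_def e_def)
    also have "\<dots> = (1 / real e + z (Suc n) / (real e * real (e - 1))) / real (?p n)"
      using e pos[of n] by (intro luroth_remainder_step) simp_all
    also have "1 / real e + z (Suc n) / (real e * real (e - 1)) = z n"
      using DT[OF z[of n]] unfolding eD by (simp only: z_def funpow.simps o_apply)
    finally show ?case using Suc by simp
  qed
  have "(\<lambda>n. z n / real (?p n)) \<longlonglongrightarrow> 0"
  proof (rule tendsto_sandwich[OF _ _ tendsto_const])
    show "\<forall>\<^sub>F n in sequentially. 0 \<le> z n / real (?p n)"
      using z by (intro always_eventually allI divide_nonneg_nonneg) (auto simp: less_imp_le)
    show "\<forall>\<^sub>F n in sequentially. z n / real (?p n) \<le> (1 / 2) ^ n"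
    proof (intro always_eventually allI)
      fix n
      have "(2::real) ^ n \<le> real (?p n)"
        using p2[of n] by (metis of_nat_le_iff of_nat_numeral of_nat_power)
      then have "z n / real (?p n) \<le> 1 / 2 ^ n"
        using z[of n] by (intro frac_le) auto
      then show "z n / real (?p n) \<le> (1 / 2) ^ n" by (simp add: power_one_over)
    qed
    show "(\<lambda>n. (1 / 2) ^ n) \<longlonglongrightarrow> (0::real)" by (rule LIMSEQ_power_zero) simp
  qed
  then have "(\<lambda>n. x - z n / real (?p n)) \<longlonglongrightarrow> x - 0"
    by (intro tendsto_diff tendsto_const)
  moreover have "(\<lambda>n. x - z n / real (?p n)) = (\<lambda>n. \<Sum>k<n. ?t k)"
    using rem by (auto simp: fun_eq_iff algebra_simps)
  ultimately have "?t sums x" by (simp add: sums_def)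
  then have ex: "is_luroth_expansion d x"
    using d2 by (simp add: is_luroth_expansion_def d_def)
  moreover have "d' = d''" if "is_luroth_expansion d' x" "is_luroth_expansion d'' x" for d' d''
  proof
    fix n
    show "d' n = d'' n"
      using that luroth_digits_eq[of d' x d''] by (cases n) (auto simp: is_luroth_expansion_def)
  qed
  ultimately show ?thesis by blast
qed

end

theory Submission
  imports Defs "HOL-Real_Asymp.Real_Asymp"
begin

text \<open>
  A word \<open>w\<close> of digits gives the cylinder of length \<open>1 / word_prod w\<close>, and \<open>P\<^sub>n / Q\<^sub>n\<close> is the
  point of the cylinder of the first \<open>n - 1\<close> digits with tail \<open>1 / d\<^sub>n\<close>.

  For the upper bound, \<open>L(\<psi>)\<close> is covered by the balls around the points \<open>P\<^sub>n / Q\<^sub>n\<close>, \<open>n > N\<close>; the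
  sum of \<open>Q\<^sub>n powr - a\<close> over all words factorises over the digits and, as the numbers
  \<open>1 / (d (d - 1))\<close> sum to \<open>1\<close>, decays geometrically in \<open>N\<close> for every \<open>a > 1\<close>.

  For the lower bound, \<open>(\<psi> q / q) powr s = \<theta> q / q\<close> shows that \<open>\<psi> q / q\<close> is non-increasing, so at a
  scale \<open>X\<close> with \<open>\<psi> X \<ge> X powr - b\<close> every point \<open>P\<^sub>n / Q\<^sub>n\<close> with \<open>Q\<^sub>n \<le> X\<close> may be approximated to within
  \<open>\<psi> X / X\<close>. Appending the digit \<open>2\<close> to a word shows that the midpoints of the cylinders are such
  points, and cylinders of length between \<open>2 / X\<close> and \<open>X powr (\<epsilon> - 1)\<close> fill most of any given interval.
  Given a cover \<open>U\<close> with small \<open>\<Sum> diameter (U j) powr t\<close>, nested intervals \<open>I\<close> around such midpoints are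
  chosen so that the part of this sum over the \<open>U j\<close> meeting \<open>I\<close> stays below a constant times
  \<open>\<bar>I\<bar> powr t\<close>: the \<open>U j\<close> meeting several candidates for the next interval spoil only a quarter of
  the length, the others meet one candidate each, and averaging applies. The common point of
  the nested intervals then lies in \<open>L(\<psi>)\<close> but in no \<open>U j\<close>.
\<close>

section \<open>Cylinders and convergents\<close>


text \<open>The inverse branch of the Lueroth shift: it prepends the digit \<open>d\<close> to the
  expansion of \<open>y\<close> and, for \<open>d \<ge> 2\<close>, maps (0,1] onto (1/d,
  1/(d-1)].\<close>

definition luroth_branch :: "nat \<Rightarrow> real \<Rightarrow> real" where
  "luroth_branch d y = 1 / real d + y / (real d * real (d - 1))"

definition luroth_map :: "nat list \<Rightarrow> real \<Rightarrow> real" where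
  "luroth_map w y = foldr luroth_branch w y"

definition word_prod :: "nat list \<Rightarrow> nat" where
  "word_prod w = prod_list (map (\<lambda>d. d * (d - 1)) w)"

lemma luroth_map_simps [simp]:
  "luroth_map [] y = y" "luroth_map (d # w) y = luroth_branch d (luroth_map w y)"
  by (simp_all add: luroth_map_def)

lemma word_prod_simps [simp]:
  "word_prod [] = 1" "word_prod (d # w) = d * (d - 1) * word_prod w"
  by (simp_all add: word_prod_def)

text \<open>Each branch is affine with slope \<open>1 / (d (d - 1))\<close>, and slopes multiply
  under composition. At \<open>y = 1\<close> this gives the length of the cylinder of
  \<open>w\<close>.\<close>

lemma luroth_map_affine: "luroth_map w y = luroth_map w 0 + y / real (word_prod w)"
proof (induction w)
  case (Cons d w)
  show ?case
    by (subst luroth_map_simps, subst Cons)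
      (simp add: luroth_branch_def add_divide_distrib mult_ac)
qed simp

lemma word_prod_pos: "set w \<subseteq> {2..} \<Longrightarrow> 0 < word_prod w"
  by (induction w) auto

lemma luroth_branch_in:
  assumes "2 \<le> d" "y \<in> {0<..1}"
  shows "luroth_branch d y \<in> {1 / real d<..1 / real (d - 1)}"
  using luroth_first_digit[OF assms(1), of y] assms by (auto simp: luroth_branch_def)

lemma luroth_branch_in_unit:
  assumes "2 \<le> d" "y \<in> {0<..1}"
  shows "luroth_branch d y \<in> {0<..1}"
proof -
  have "1 / real (d - 1) \<le> 1" "0 < 1 / real d" using assms(1) by auto
  then show ?thesis
    using luroth_branch_in[OF assms] unfolding greaterThanAtMost_iff by (meson less_trans order_trans)
qed

lemma luroth_map_in_unit:
  "set w \<subseteq> {2..} \<Longrightarrow> y \<in> {0<..1} \<Longrightarrow> luroth_map w y \<in> {0<..1}"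
  using luroth_branch_in_unit by (induction w) auto

section \<open>Digits, denominators and convergents under the branches\<close>

lemma luroth_denom_cong:
  assumes "\<And>k. 1 \<le> k \<Longrightarrow> d k = d' k"
  shows "luroth_denom d (Suc k) = luroth_denom d' (Suc k)"
  using assms unfolding luroth_denom_def by (intro arg_cong2[where f = "(*)"] prod.cong) auto

lemma is_luroth_expansion_digits:
  "x \<in> {0<..1} \<Longrightarrow> is_luroth_expansion (luroth_digits x) x"
  unfolding luroth_digits_def by (rule theI'[OF luroth_expansion_unique]) auto

text \<open>Putting \<open>d\<close> in front of the digits of \<open>y\<close> multiplies all their
  denominators by \<open>d (d - 1)\<close>, so the new series sums to
  \<open>1 / d + y / (d (d - 1))\<close>; uniqueness of the expansion does the rest.\<close>

lemma luroth_digits_branch: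
  assumes d: "2 \<le> d" and y: "y \<in> {0<..1}"
  shows "luroth_digits (luroth_branch d y) =
    (\<lambda>n. if n = 0 then 0 else if n = 1 then d else luroth_digits y (n - 1))" (is "_ = ?e")
proof -
  let ?c = "real (d * (d - 1))"
  have L: "is_luroth_expansion (luroth_digits y) y"
    using y by (rule is_luroth_expansion_digits)
  have shift: "luroth_denom ?e (Suc (Suc k)) = d * (d - 1) * luroth_denom (luroth_digits y) (Suc k)" for k
  proof -
    \<comment> \<open>The two sequences differ only at index 0, which enters no denominator of
      positive index.\<close>
    have "luroth_denom (?e \<circ> Suc) (Suc k) = luroth_denom (luroth_digits y) (Suc k)"
      by (rule luroth_denom_cong) auto
    then show ?thesis unfolding luroth_denom_Suc_shift by simp
  qed
  have "(\<lambda>k. 1 / real (luroth_denom ?e (Suc (Suc k)))) sums (y / ?c)"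
    using L sums_divide[of "\<lambda>k. 1 / real (luroth_denom (luroth_digits y) (Suc k))" y ?c]
    unfolding is_luroth_expansion_def shift by (simp add: mult_ac)
  then have "(\<lambda>k. 1 / real (luroth_denom ?e (Suc k))) sums (y / ?c + 1 / real (luroth_denom ?e (Suc 0)))"
    by (subst (asm) sums_Suc_iff)
  moreover have "y / ?c + 1 / real (luroth_denom ?e (Suc 0)) = luroth_branch d y"
    by (simp add: luroth_denom_def luroth_branch_def)
  ultimately have "is_luroth_expansion ?e (luroth_branch d y)"
    using L d unfolding is_luroth_expansion_def by auto
  then show ?thesis
    unfolding luroth_digits_def[of "luroth_branch d y"] using luroth_branch_in_unit[OF d y]
    by (intro the1_equality[OF luroth_expansion_unique]) auto
qed

lemma luroth_denom_digits_branch: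
  assumes "2 \<le> d" "y \<in> {0<..1}"
  shows "luroth_denom (luroth_digits (luroth_branch d y)) (Suc 0) = d"
    "luroth_denom (luroth_digits (luroth_branch d y)) (Suc (Suc k)) =
       d * (d - 1) * luroth_denom (luroth_digits y) (Suc k)"
proof -
  show "luroth_denom (luroth_digits (luroth_branch d y)) (Suc 0) = d"
    using assms by (simp add: luroth_digits_branch luroth_denom_def)
  have "luroth_denom (luroth_digits (luroth_branch d y) \<circ> Suc) (Suc k)
      = luroth_denom (luroth_digits y) (Suc k)"
    by (rule luroth_denom_cong) (use assms in \<open>simp add: luroth_digits_branch\<close>)
  then show "luroth_denom (luroth_digits (luroth_branch d y)) (Suc (Suc k)) =
       d * (d - 1) * luroth_denom (luroth_digits y) (Suc k)"
    unfolding luroth_denom_Suc_shift using assms by (simp add: luroth_digits_branch)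
qed

text \<open>This is P_n / Q_n with the factor Q_n of \<open>luroth_P\<close> already cancelled; in
  this form a branch acts on it directly.\<close>

definition luroth_convergent :: "nat \<Rightarrow> real \<Rightarrow> real" where
  "luroth_convergent n x = (\<Sum>k = 1..n. 1 / real (luroth_denom (luroth_digits x) k))"

lemma luroth_convergent_branch:
  assumes "2 \<le> d" "y \<in> {0<..1}"
  shows "luroth_convergent (Suc n) (luroth_branch d y) = luroth_branch d (luroth_convergent n y)"
proof -
  let ?D = "luroth_denom (luroth_digits (luroth_branch d y))"
  have "luroth_convergent (Suc n) (luroth_branch d y) = 1 / real (?D (Suc 0)) + (\<Sum>k = Suc 1..Suc n. 1 / real (?D k))"
    unfolding luroth_convergent_def by (subst sum.atLeast_Suc_atMost) auto
  also have "(\<Sum>k = Suc 1..Suc n. 1 / real (?D k)) = (\<Sum>k = 1..n. 1 / real (?D (Suc k)))"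
    by (rule sum.shift_bounds_cl_Suc_ivl)
  also have "\<dots> = (\<Sum>k = 1..n. 1 / real (luroth_denom (luroth_digits y) k) / (real d * real (d - 1)))"
  proof (rule sum.cong)
    fix k assume "k \<in> {1..n}"
    then obtain j where "k = Suc j" by (cases k) auto
    then show "1 / real (?D (Suc k)) = 1 / real (luroth_denom (luroth_digits y) k) / (real d * real (d - 1))"
      using luroth_denom_digits_branch(2)[OF assms, of j] by simp
  qed simp
  finally show ?thesis
    using luroth_denom_digits_branch(1)[OF assms]
    by (simp add: luroth_branch_def luroth_convergent_def sum_divide_distrib)
qed

text \<open>Induction on \<open>w\<close>: a further branch multiplies Q_n by its
  \<open>d (d - 1)\<close> and is applied to the convergent. The tail \<open>y\<close> drops out, so
  both quantities are constant on the cylinder of \<open>w\<close> followed by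
  \<open>d\<close>.\<close>

lemma luroth_map_Q_convergent:
  assumes "set w \<subseteq> {2..}" "2 \<le> d" "y \<in> {0<..1}"
  defines "x \<equiv> luroth_map w (luroth_branch d y)"
  shows "luroth_Q (Suc (length w)) x = word_prod w * d"
    "luroth_P (Suc (length w)) x / real (luroth_Q (Suc (length w)) x) = luroth_map w (1 / real d)"
proof -
  have "luroth_Q (Suc (length w)) x = word_prod w * d \<and>
      luroth_convergent (Suc (length w)) x = luroth_map w (1 / real d)"
    using assms(1) unfolding x_def
  proof (induction w)
    case Nil
    then show ?case
      using assms(2,3) luroth_denom_digits_branch(1)[OF assms(2,3)]
        luroth_convergent_branch[OF assms(2,3), of 0]
      by (simp add: luroth_Q_def luroth_convergent_def luroth_branch_def)
  next
    case (Cons e w)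
    let ?x = "luroth_map w (luroth_branch d y)"
    have x: "?x \<in> {0<..1}"
      using Cons.prems assms luroth_branch_in_unit luroth_map_in_unit by simp
    show ?case
      using Cons luroth_denom_digits_branch(2)[OF _ x, of e "length w"]
        luroth_convergent_branch[OF _ x, of e]
      by (simp add: luroth_Q_def mult_ac)
  qed
  moreover have "0 < word_prod w * d"
    using assms word_prod_pos by simp
  ultimately show "luroth_Q (Suc (length w)) x = word_prod w * d"
    "luroth_P (Suc (length w)) x / real (luroth_Q (Suc (length w)) x) = luroth_map w (1 / real d)"
    by (simp_all add: luroth_P_def luroth_convergent_def)
qed

lemma luroth_map_exists:
  assumes "x \<in> {0<..1}"
  shows "\<exists>w y. length w = n \<and> set w \<subseteq> {2..} \<and> y \<in> {0<..1} \<and> x = luroth_map w y"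
  using assms
proof (induction n arbitrary: x)
  case 0
  then show ?case by (intro exI[of _ "[]"] exI[of _ x]) simp
next
  case (Suc n)
  then obtain m y where m: "2 \<le> (m::nat)" "0 < y" "y \<le> 1" "x = luroth_branch m y"
    using luroth_step_exists[of x] unfolding luroth_branch_def by auto
  then obtain w z where "length w = n" "set w \<subseteq> {2..}" "z \<in> {0<..1}" "y = luroth_map w z"
    using Suc.IH[of y] by auto
  then show ?case using m by (intro exI[of _ "m # w"] exI[of _ z]) simp
qed

lemma luroth_map_branch_exists:
  assumes "x \<in> {0<..1}"
  obtains w d y where "length w = n" "set w \<subseteq> {2..}" "2 \<le> d" "y \<in> {0<..1}"
    "x = luroth_map w (luroth_branch d y)"
proof -
  obtain w y where w: "length w = n" "set w \<subseteq> {2..}" "y \<in> {0<..1}" "x = luroth_map w y"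
    using luroth_map_exists[OF assms] by blast
  obtain m z where "2 \<le> (m::nat)" "0 < z" "z \<le> 1" "y = luroth_branch m z"
    using luroth_step_exists[of y] w(3) unfolding luroth_branch_def by auto
  then show ?thesis using w that by auto
qed

section \<open>Hausdorff measure and sums over words\<close>


text \<open>Allows covers indexed by any countable type, such as pairs of a word and a digit. They
  are transported along \<open>to_nat\<close>, with \<open>{}\<close> at the remaining indices,
  which costs 0; bounds on finite partial sums suffice since all terms are nonnegative.\<close>

lemma hausdorff_measure_eq_0I:
  fixes B :: "'i::countable \<Rightarrow> 'a::metric_space set"
  assumes "\<And>\<delta> \<epsilon>. 0 < \<delta> \<Longrightarrow> 0 < \<epsilon> \<Longrightarrow> \<exists>K. A \<subseteq> (\<Union>i\<in>K. B i) \<and>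
      (\<forall>i\<in>K. bounded (B i) \<and> diameter (B i) \<le> \<delta>) \<and>
      (\<forall>F. finite F \<and> F \<subseteq> K \<longrightarrow> (\<Sum>i\<in>F. diam_power t (B i)) \<le> \<epsilon>)"
  shows "hausdorff_measure t A = 0"
proof -
  have "hausdorff_premeasure t \<delta> A \<le> 0" if \<delta>: "0 < \<delta>" for \<delta>
  proof (rule ennreal_le_epsilon)
    fix \<epsilon> :: real assume "0 < \<epsilon>"
    then obtain K where K: "A \<subseteq> (\<Union>i\<in>K. B i)"
      "\<And>i. i \<in> K \<Longrightarrow> bounded (B i) \<and> diameter (B i) \<le> \<delta>"
      "\<And>F. finite F \<Longrightarrow> F \<subseteq> K \<Longrightarrow> (\<Sum>i\<in>F. diam_power t (B i)) \<le> \<epsilon>"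
      using assms[OF \<delta>] by metis
    define U where "U n = (if n \<in> to_nat ` K then B (from_nat n) else {})" for n
    have nonneg: "0 \<le> diam_power t C" for C :: "'a set"
      by (simp add: diam_power_def)
    have "U \<in> delta_covers \<delta> A"
    proof -
      have "A \<subseteq> (\<Union>n. U n)"
      proof
        fix x assume "x \<in> A"
        then obtain i where "i \<in> K" "x \<in> B i" using K(1) by auto
        then have "x \<in> U (to_nat i)" by (simp add: U_def)
        then show "x \<in> (\<Union>n. U n)" by blast
      qed
      then show ?thesis
        using K(2) \<delta> by (auto simp: delta_covers_def U_def)
    qed
    moreover have "(\<Sum>n. ennreal (diam_power t (U n))) \<le> ennreal \<epsilon>"
      unfolding suminf_eq_SUP
    proof (rule SUP_least)
      fix n
      define F where "F = {i \<in> K. to_nat i < n}"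
      have fin: "finite (to_nat ` F)"
        by (rule finite_subset[of _ "{..<n}"]) (auto simp: F_def)
      then have F: "finite F"
        by (rule finite_imageD) (meson inj_on_subset inj_to_nat subset_UNIV)
      have "(\<Sum>m<n. diam_power t (U m)) = (\<Sum>m\<in>to_nat ` F. diam_power t (U m))"
        by (rule sum.mono_neutral_right) (auto simp: F_def U_def diam_power_def)
      also have "\<dots> = (\<Sum>i\<in>F. diam_power t (U (to_nat i)))"
        by (rule sum.reindex_cong[of to_nat]) (auto intro: inj_on_subset inj_to_nat)
      also have "\<dots> = (\<Sum>i\<in>F. diam_power t (B i))"
        by (rule sum.cong) (auto simp: U_def F_def)
      also have "\<dots> \<le> \<epsilon>" using F by (intro K(3)) (auto simp: F_def)
      finally show "(\<Sum>m<n. ennreal (diam_power t (U m))) \<le> ennreal \<epsilon>"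
        using nonneg by (simp add: sum_ennreal ennreal_leI)
    qed
    ultimately have "hausdorff_premeasure t \<delta> A \<le> ennreal \<epsilon>"
      unfolding hausdorff_premeasure_def by (meson INF_lower2)
    then show "hausdorff_premeasure t \<delta> A \<le> 0 + ennreal \<epsilon>" by simp
  qed
  then have "hausdorff_measure t A \<le> 0"
    unfolding hausdorff_measure_def by (intro SUP_least) auto
  then show ?thesis by simp
qed

text \<open>The measure is a supremum of premeasures, so the one at scale 1 already vanishes. A
  finite \<open>ennreal\<close> sum then turns into a summable real series.\<close>

lemma hausdorff_measure_0_cover:
  fixes A :: "'a::metric_space set"
  assumes "hausdorff_measure t A = 0" "0 < \<epsilon>"
  obtains U where "A \<subseteq> (\<Union>i. U i)" "\<And>i. bounded (U i)"
    "summable (\<lambda>i. diam_power t (U i))" "(\<Sum>i. diam_power t (U i)) < \<epsilon>"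
proof -
  have nonneg: "0 \<le> diam_power t C" for C :: "'a set"
    by (simp add: diam_power_def)
  have "hausdorff_premeasure t 1 A \<le> hausdorff_measure t A"
    unfolding hausdorff_measure_def by (intro SUP_upper) auto
  then have "hausdorff_premeasure t 1 A < ennreal \<epsilon>" using assms by (simp add: ennreal_less_zero_iff)
  then obtain U where U: "U \<in> delta_covers 1 A" "(\<Sum>i. ennreal (diam_power t (U i))) < ennreal \<epsilon>"
    unfolding hausdorff_premeasure_def by (auto simp: INF_less_iff)
  have "summable (\<lambda>i. diam_power t (U i))"
    using U(2) nonneg by (intro summable_suminf_not_top) (auto simp: less_top[symmetric])
  moreover from this have "(\<Sum>i. diam_power t (U i)) < \<epsilon>"
    using U(2) nonneg assms(2) by (simp add: suminf_ennreal2 suminf_nonneg ennreal_less_iff)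
  ultimately show ?thesis using that U(1) by (auto simp: delta_covers_def)
qed

lemma hausdorff_dim_leI:
  assumes "\<And>t. a < t \<Longrightarrow> hausdorff_measure t A = 0" "0 \<le> a"
  shows "hausdorff_dim A \<le> ereal a"
proof (rule ereal_le_epsilon2)
  fix e :: real assume "0 < e"
  then show "hausdorff_dim A \<le> ereal a + ereal e"
    unfolding hausdorff_dim_def using assms by (intro Inf_lower) auto
qed

text \<open>The exponent 0 is settled by nonemptiness: some set of the cover is nonempty and
  contributes 1, so the total cannot be below 1.\<close>

lemma hausdorff_dim_geI:
  fixes A :: "'a::metric_space set"
  assumes "\<And>t. 0 < t \<Longrightarrow> t < a \<Longrightarrow> hausdorff_measure t A \<noteq> 0" "A \<noteq> {}"
  shows "ereal a \<le> hausdorff_dim A"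
  unfolding hausdorff_dim_def
proof (rule Inf_greatest, clarify)
  fix t :: real assume t: "0 \<le> t" "hausdorff_measure t A = 0"
  have "t \<noteq> 0"
  proof
    assume "t = 0"
    obtain U where U: "A \<subseteq> (\<Union>i. U i)" "\<And>i. bounded (U i)"
      "summable (\<lambda>i. diam_power t (U i))" "(\<Sum>i. diam_power t (U i)) < 1"
      by (rule hausdorff_measure_0_cover[OF t(2) zero_less_one], rule that)
    obtain i where "U i \<noteq> {}" using U(1) assms(2) by blast
    then have "1 = diam_power t (U i)" using \<open>t = 0\<close> by (simp add: diam_power_def)
    also have "\<dots> \<le> (\<Sum>i. diam_power t (U i))"
      using sum_le_suminf[OF U(3), of "{i}"] by (simp add: diam_power_def)
    finally show False using U(4) by simp
  qed
  then show "ereal a \<le> ereal t" using assms(1)[of t] t by force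
qed

section \<open>Sums over words of digits\<close>

lemma sum_lists_length:
  fixes g :: "'a \<Rightarrow> real"
  assumes "finite A"
  shows "(\<Sum>w | set w \<subseteq> A \<and> length w = n. prod_list (map g w)) = (\<Sum>d\<in>A. g d) ^ n"
proof (induction n)
  case 0
  have "{w. set w \<subseteq> A \<and> length w = 0} = {[]}" by auto
  then show ?case by simp
next
  case (Suc n)
  let ?W = "{w. set w \<subseteq> A \<and> length w = n}"
  have eq: "{w. set w \<subseteq> A \<and> length w = Suc n} = (\<lambda>(d, w). d # w) ` (A \<times> ?W)"
    by (auto simp: length_Suc_conv image_iff)
  have "(\<Sum>w | set w \<subseteq> A \<and> length w = Suc n. prod_list (map g w)) =
      (\<Sum>(d, w)\<in>A \<times> ?W. g d * prod_list (map g w))"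
    unfolding eq by (subst sum.reindex) (auto simp: inj_on_def case_prod_beta)
  also have "\<dots> = (\<Sum>d\<in>A. g d) * (\<Sum>w\<in>?W. prod_list (map g w))"
    by (simp add: sum.cartesian_product[symmetric] sum_product)
  finally show ?case using Suc by simp
qed

text \<open>Telescoping, as \<open>1 / (d (d - 1)) = 1 / (d - 1) - 1 / d\<close>. The deficit
  \<open>1 / M\<close> is the length of (0, 1/M], where the first digit exceeds
  \<open>M\<close>.\<close>

lemma luroth_digit_sum: "2 \<le> M \<Longrightarrow> (\<Sum>d = 2..M. 1 / (real d * real (d - 1))) = 1 - 1 / real M"
proof (induction M rule: nat_induct_at_least)
  case base
  then show ?case by simp
next
  case (Suc n)
  have "(\<Sum>d = 2..Suc n. 1 / (real d * real (d - 1))) = 1 - 1 / real n + 1 / (real (Suc n) * real n)"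
    using Suc by simp
  also have "\<dots> = 1 - 1 / real (Suc n)"
    using Suc.hyps by (simp add: divide_simps) (simp add: algebra_simps)
  finally show ?case .
qed

text \<open>With \<open>q = d (d - 1) \<ge> 2\<close>, each term is \<open>1 / q\<close> times
  \<open>q powr (1 - a)\<close>, and the latter is at most \<open>2 powr (1 - a)\<close>; the
  numbers \<open>1 / q\<close> sum to at most 1.\<close>

lemma luroth_digit_powr_sum_le:
  assumes "1 \<le> a"
  shows "(\<Sum>d = 2..M. real (d * (d - 1)) powr - a) \<le> 2 powr (1 - a)"
proof -
  have "real (d * (d - 1)) powr - a \<le> 1 / (real d * real (d - 1)) * 2 powr (1 - a)" if "d \<in> {2..M}" for d
  proof -
    define q where "q = real (d * (d - 1))"
    have "2 * 1 \<le> d * (d - 1)" using that by (intro mult_le_mono) auto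
    then have q: "2 \<le> q" unfolding q_def by linarith
    then have "q powr (1 - a) \<le> 2 powr (1 - a)"
      using assms by (intro powr_mono2') auto
    then have "q powr (1 - a) / q \<le> 2 powr (1 - a) / q"
      using q by (intro divide_right_mono) auto
    moreover have "q powr (1 - a) / q = q powr - a"
      using q powr_diff[of q "1 - a" 1] by simp
    ultimately show ?thesis unfolding q_def by simp
  qed
  then have "(\<Sum>d = 2..M. real (d * (d - 1)) powr - a) \<le> (\<Sum>d = 2..M. 1 / (real d * real (d - 1))) * 2 powr (1 - a)"
    unfolding sum_distrib_right by (rule sum_mono)
  also have "\<dots> \<le> 1 * 2 powr (1 - a)"
  proof (intro mult_right_mono)
    show "(\<Sum>d = 2..M. 1 / (real d * real (d - 1))) \<le> 1"
      using luroth_digit_sum[of M] by (cases "2 \<le> M") auto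
  qed simp
  finally show ?thesis by simp
qed

lemma word_prod_powr: "real (word_prod w) powr a = prod_list (map (\<lambda>d. real (d * (d - 1)) powr a) w)"
  by (induction w) (simp_all add: powr_mult)

text \<open>Every letter of \<open>w\<close> contributes a factor of at most
  \<open>\<rho> = 2 powr (1 - a) < 1\<close>, and the last digit \<open>d\<close> contributes at
  most \<open>\<zeta>\<close>. Summing the geometric series over the lengths from \<open>N\<close>
  on gives \<open>C = \<zeta> / (1 - \<rho>)\<close>.\<close>

lemma luroth_word_powr_sum:
  assumes a: "1 < a"
  obtains C where "0 \<le> C" "\<And>N F. finite F \<Longrightarrow> F \<subseteq> {(w, d). set w \<subseteq> {2..} \<and> 2 \<le> d \<and> N \<le> length w} \<Longrightarrow>
    (\<Sum>(w, d)\<in>F. real (word_prod w * d) powr - a) \<le> C * (2 powr (1 - a)) ^ N"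
proof -
  define \<zeta> where "\<zeta> = (\<Sum>d. real d powr - a)"
  define \<rho> :: real where "\<rho> = 2 powr (1 - a)"
  have \<rho>: "0 < \<rho>" "\<rho> < 1" using a powr_less_mono[of "1 - a" 0 2] by (auto simp: \<rho>_def)
  have sm: "summable (\<lambda>d. real d powr - a)" using a by (simp add: summable_real_powr_iff)
  have \<zeta>: "0 \<le> \<zeta>" unfolding \<zeta>_def by (intro suminf_nonneg sm) auto
  have "(\<Sum>(w, d)\<in>F. real (word_prod w * d) powr - a) \<le> \<zeta> / (1 - \<rho>) * \<rho> ^ N"
    if F: "finite F" "F \<subseteq> {(w, d). set w \<subseteq> {2..} \<and> 2 \<le> d \<and> N \<le> length w}" for N F
  proof -
    \<comment> \<open>\<open>M\<close> bounds the digits and \<open>H\<close> the word lengths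
      occurring in \<open>F\<close>, so \<open>F\<close> lies in a finite product set over which the
      sum factorises.\<close>
    define M where "M = Max (insert 2 (\<Union>(w, d)\<in>F. insert d (set w)))"
    define H where "H = Max (insert N ((\<lambda>(w, d). length w) ` F))"
    have M: "d \<le> M" "set w \<subseteq> {..M}" if "(w, d) \<in> F" for w d
      unfolding M_def using that F(1) by (auto intro!: Max_ge)
    have H: "length w \<le> H" if "(w, d) \<in> F" for w d
      unfolding H_def using that F(1) by (intro Max_ge) force+
    define W where "W n = {w. set w \<subseteq> {2..M} \<and> length w = n}" for n
    have finW: "finite (W n)" for n unfolding W_def by (intro finite_lists_length_eq) simp
    have "F \<subseteq> (\<Union>n\<in>{N..H}. W n) \<times> {2..M}"
      using F(2) M H by (fastforce simp: W_def)
    then have "(\<Sum>(w, d)\<in>F. real (word_prod w * d) powr - a)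
        \<le> (\<Sum>(w, d)\<in>(\<Union>n\<in>{N..H}. W n) \<times> {2..M}. real (word_prod w * d) powr - a)"
      using finW by (intro sum_mono2) auto
    also have "\<dots> = (\<Sum>w\<in>(\<Union>n\<in>{N..H}. W n). real (word_prod w) powr - a) * (\<Sum>d = 2..M. real d powr - a)"
      by (simp add: sum.cartesian_product[symmetric] sum_product powr_mult)
    also have "(\<Sum>w\<in>(\<Union>n\<in>{N..H}. W n). real (word_prod w) powr - a) =
        (\<Sum>n = N..H. \<Sum>w\<in>W n. real (word_prod w) powr - a)"
      using finW by (intro sum.UNION_disjoint) (auto simp: W_def)
    also have "\<dots> = (\<Sum>n = N..H. (\<Sum>d = 2..M. real (d * (d - 1)) powr - a) ^ n)"
      unfolding word_prod_powr W_def by (simp add: sum_lists_length)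
    also have "\<dots> * (\<Sum>d = 2..M. real d powr - a) \<le> (\<rho> ^ N / (1 - \<rho>)) * \<zeta>"
    proof (rule mult_mono)
      have "(\<Sum>n = N..H. (\<Sum>d = 2..M. real (d * (d - 1)) powr - a) ^ n) \<le> (\<Sum>n = N..H. \<rho> ^ n)"
        using a luroth_digit_powr_sum_le[of a M]
        by (intro sum_mono power_mono) (auto simp: \<rho>_def intro: sum_nonneg)
      also have "\<dots> \<le> \<rho> ^ N / (1 - \<rho>)"
        using \<rho> by (auto simp: sum_gp divide_simps)
      finally show "(\<Sum>n = N..H. (\<Sum>d = 2..M. real (d * (d - 1)) powr - a) ^ n) \<le> \<rho> ^ N / (1 - \<rho>)" .
      show "(\<Sum>d = 2..M. real d powr - a) \<le> \<zeta>"
        unfolding \<zeta>_def by (intro sum_le_suminf sm) auto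
    qed (use \<rho> in \<open>auto intro: sum_nonneg\<close>)
    finally show ?thesis by (simp add: mult_ac)
  qed
  then show ?thesis using that[of "\<zeta> / (1 - \<rho>)"] \<zeta> \<rho> unfolding \<rho>_def by auto
qed

section \<open>Upper bound\<close>


lemma mem_luroth_L_iff:
  "x \<in> luroth_L \<psi> \<longleftrightarrow> (\<forall>N. \<exists>n\<ge>N. x \<in> {0<..1} \<and>
     \<bar>x - luroth_P n x / real (luroth_Q n x)\<bar> < \<psi> (luroth_Q n x) / real (luroth_Q n x))"
  unfolding luroth_L_def limsup_INF_SUP by auto

lemma power_le_word_prod: "set w \<subseteq> {2..} \<Longrightarrow> 2 ^ length w \<le> word_prod w"
proof (induction w)
  case (Cons d w)
  have "2 * 1 \<le> d * (d - 1)" using Cons.prems by (intro mult_le_mono) auto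
  then show ?case using Cons by (auto intro!: mult_le_mono)
qed simp

text \<open>The ball with centre P_n / Q_n has radius at most \<open>Q powr (- 1 - b)\<close>, where
  \<open>Q\<close> is Q_n, so its cost is at most \<open>2 powr t * Q powr - a\<close> with
  \<open>a = (1 + b) * t > 1\<close>, and the sum over words of length at least \<open>N\<close>
  tends to 0.\<close>

lemma hausdorff_measure_luroth_L_eq_0:
  assumes psi: "\<And>q. 1 \<le> q \<Longrightarrow> 0 < \<psi> q \<and> \<psi> q \<le> 1"
    and decay: "\<And>q. q\<^sub>0 \<le> q \<Longrightarrow> \<psi> q \<le> real q powr - b"
    and t: "0 < t" "1 < (1 + b) * t"
  shows "hausdorff_measure t (luroth_L \<psi>) = 0"
proof -
  define a where "a = (1 + b) * t"
  have a: "1 < a" using t by (simp add: a_def)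
  define B where "B = (\<lambda>(w, d). cball (luroth_map w (1 / real d))
      (\<psi> (word_prod w * d) / real (word_prod w * d)))"
  obtain C where C: "0 \<le> C" "\<And>N F. finite F \<Longrightarrow>
      F \<subseteq> {(w, d). set w \<subseteq> {2..} \<and> 2 \<le> d \<and> N \<le> length w} \<Longrightarrow>
      (\<Sum>(w, d)\<in>F. real (word_prod w * d) powr - a) \<le> C * (2 powr (1 - a)) ^ N"
    using luroth_word_powr_sum[OF a] by blast
  show ?thesis
  proof (rule hausdorff_measure_eq_0I[of _ B])
    fix \<delta> \<epsilon> :: real assume \<delta>: "0 < \<delta>" and \<epsilon>: "0 < \<epsilon>"
    have "\<forall>\<^sub>F N in sequentially. Z \<le> 2 ^ N" for Z :: real
      using filterlim_realpow_sequentially_gt1[of "2::real"]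
      by (simp add: filterlim_at_infinity_conv_norm_at_top filterlim_at_top)
    note this[of "real q\<^sub>0"] this[of "2 / \<delta>"]
    moreover have "\<forall>\<^sub>F N in sequentially. 2 powr t * C * (2 powr (1 - a)) ^ N < \<epsilon>"
    proof -
      have "2 powr (1 - a) < 1"
        using a powr_less_mono[of "1 - a" 0 2] by simp
      then have "(\<lambda>N. 2 powr t * C * (2 powr (1 - a)) ^ N) \<longlonglongrightarrow> 2 powr t * C * 0"
        by (intro tendsto_intros LIMSEQ_power_zero) auto
      then show ?thesis using \<epsilon> by (intro order_tendstoD(2)) auto
    qed
    \<comment> \<open>Words with at least \<open>N\<close> letters have denominators at least
      \<open>2 ^ N\<close>: the first condition makes \<open>decay\<close> applicable, the second
      bounds the diameters by \<open>\<delta>\<close>, the third bounds the total cost.\<close>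
    ultimately have "\<forall>\<^sub>F N in sequentially. real q\<^sub>0 \<le> 2 ^ N \<and> 2 / \<delta> \<le> 2 ^ N \<and>
        2 powr t * C * (2 powr (1 - a)) ^ N < \<epsilon>" by eventually_elim auto
    then obtain N where N: "real q\<^sub>0 \<le> 2 ^ N" "2 / \<delta> \<le> 2 ^ N"
        "2 powr t * C * (2 powr (1 - a)) ^ N < \<epsilon>"
      by (auto simp: eventually_sequentially)
    define K :: "(nat list \<times> nat) set" where "K = {(w, d). set w \<subseteq> {2..} \<and> 2 \<le> d \<and> N \<le> length w}"
    have Q: "2 ^ N \<le> real (word_prod w * d)" if "(w, d) \<in> K" for w d
    proof -
      have "(2::nat) ^ N \<le> 2 ^ length w"
        using that by (intro power_increasing) (auto simp: K_def)
      also have "\<dots> \<le> word_prod w" using that power_le_word_prod by (auto simp: K_def)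
      also have "\<dots> \<le> word_prod w * d" using that by (auto simp: K_def)
      finally show ?thesis by (metis of_nat_le_iff of_nat_numeral of_nat_power)
    qed
    have diam: "diameter (B (w, d)) = 2 * (\<psi> (word_prod w * d) / real (word_prod w * d))"
      "B (w, d) \<noteq> {}" "0 < \<psi> (word_prod w * d) / real (word_prod w * d)"
      if "(w, d) \<in> K" for w d
    proof -
      have "(0::real) < 2 ^ N" by simp
      then have pos: "0 < real (word_prod w * d)" using Q[OF that] by linarith
      then have "0 < word_prod w * d" by linarith
      then show *: "0 < \<psi> (word_prod w * d) / real (word_prod w * d)"
        using psi[of "word_prod w * d"] pos by simp
      show "diameter (B (w, d)) = 2 * (\<psi> (word_prod w * d) / real (word_prod w * d))"
        using * unfolding B_def prod.case diameter_cball by simp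
      show "B (w, d) \<noteq> {}" using * unfolding B_def prod.case by simp
    qed
    show "\<exists>K. luroth_L \<psi> \<subseteq> (\<Union>i\<in>K. B i) \<and>
      (\<forall>i\<in>K. bounded (B i) \<and> diameter (B i) \<le> \<delta>) \<and>
      (\<forall>F. finite F \<and> F \<subseteq> K \<longrightarrow> (\<Sum>i\<in>F. diam_power t (B i)) \<le> \<epsilon>)"
    proof (intro exI[of _ K] conjI ballI allI impI)
      show "luroth_L \<psi> \<subseteq> (\<Union>i\<in>K. B i)"
      proof
        fix x assume "x \<in> luroth_L \<psi>"
        then obtain n where n: "Suc N \<le> n" "x \<in> {0<..1}"
          "\<bar>x - luroth_P n x / real (luroth_Q n x)\<bar> < \<psi> (luroth_Q n x) / real (luroth_Q n x)"
          unfolding mem_luroth_L_iff by blast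
        obtain m where m: "n = Suc m" "N \<le> m" using n(1) by (cases n) auto
        obtain w d y where w: "length w = m" "set w \<subseteq> {2..}" "2 \<le> d" "y \<in> {0<..1}"
            "x = luroth_map w (luroth_branch d y)"
          using luroth_map_branch_exists[OF n(2)] by blast
        have "(w, d) \<in> K" using w m by (auto simp: K_def)
        moreover have "x \<in> B (w, d)"
          using n(3) luroth_map_Q_convergent[OF w(2-4)] unfolding m w(5)[symmetric] B_def
          by (simp add: w(1) dist_real_def abs_minus_commute)
        ultimately show "x \<in> (\<Union>i\<in>K. B i)" by blast
      qed
    next
      fix i assume "i \<in> K"
      show "bounded (B i)" by (cases i) (simp add: B_def)
    next
      fix i assume i: "i \<in> K"
      obtain w d where wd: "i = (w, d)" by (cases i)
      define q where "q = word_prod w * d"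
      have q: "2 ^ N \<le> real q" using Q i unfolding wd q_def by blast
      have "(0::real) < 2 ^ N" by simp
      then have "0 < real q" using q by linarith
      then have "1 \<le> q" by linarith
      have "diameter (B i) \<le> 2 / real q"
        using diam(1)[of w d] i psi[OF \<open>1 \<le> q\<close>] unfolding wd q_def[symmetric]
        by (simp add: divide_right_mono)
      also have "\<dots> \<le> 2 / 2 ^ N" using q \<open>0 < real q\<close> by (intro divide_left_mono) auto
      also have "\<dots> \<le> \<delta>"
        using \<delta> N(2) by (simp add: field_simps)
      finally show "diameter (B i) \<le> \<delta>" .
    next
      fix F assume F: "finite F \<and> F \<subseteq> K"
      have "diam_power t (B (w, d)) \<le> 2 powr t * real (word_prod w * d) powr - a" if "(w, d) \<in> F" for w d
      proof -
        have K: "(w, d) \<in> K" using F that by blast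
        define q where "q = word_prod w * d"
        have q: "2 ^ N \<le> real q" using Q K unfolding q_def by blast
        have "(0::real) < 2 ^ N" by simp
        then have "0 < real q" using q by linarith
        have "real q\<^sub>0 \<le> real q" using N(1) q by linarith
        then have "\<psi> q / real q \<le> real q powr - b / real q"
          using \<open>0 < real q\<close> decay[of q] by (simp add: divide_right_mono)
        also have "\<dots> = real q powr (- b - 1)"
          using \<open>0 < real q\<close>
          by (simp add: powr_diff)
        finally have "(2 * (\<psi> q / real q)) powr t \<le> (2 * real q powr (- b - 1)) powr t"
          using diam(3)[OF K] t unfolding q_def[symmetric] by (intro powr_mono2) auto
        also have "\<dots> = 2 powr t * real q powr - a"
        proof -
          have "(- b - 1) * t = - a" unfolding a_def by algebra
          then show ?thesis by (simp add: powr_mult powr_powr)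
        qed
        finally show ?thesis
          using diam[OF K] t unfolding diam_power_def q_def by simp
      qed
      then have "(\<Sum>i\<in>F. diam_power t (B i)) \<le> (\<Sum>(w, d)\<in>F. 2 powr t * real (word_prod w * d) powr - a)"
        by (intro sum_mono) auto
      also have "\<dots> = 2 powr t * (\<Sum>(w, d)\<in>F. real (word_prod w * d) powr - a)"
        by (simp add: sum_distrib_left case_prod_unfold)
      also have "\<dots> \<le> 2 powr t * (C * (2 powr (1 - a)) ^ N)"
        using F C(2)[of F N] unfolding K_def by (intro mult_left_mono) auto
      also have "\<dots> \<le> \<epsilon>" using N(3) by (simp add: mult.assoc)
      finally show "(\<Sum>i\<in>F. diam_power t (B i)) \<le> \<epsilon>" .
    qed
  qed
qed

section \<open>Families of cylinders filling an interval\<close>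


text \<open>Given by its end points so that length and inclusions can be read off; for digits at
  least 2 it is the set of all \<open>luroth_map w y\<close> with \<open>y\<close> in (0,1].\<close>

definition luroth_cyl :: "nat list \<Rightarrow> real set" where
  "luroth_cyl w = {luroth_map w 0<..luroth_map w 0 + 1 / real (word_prod w)}"

lemma luroth_cyl_eq_image:
  assumes "set w \<subseteq> {2..}"
  shows "luroth_cyl w = luroth_map w ` {0<..1}"
proof -
  have p: "0 < real (word_prod w)" using word_prod_pos[OF assms] by simp
  show ?thesis
  proof (intro equalityI subsetI)
    fix x assume "x \<in> luroth_cyl w"
    then have "(x - luroth_map w 0) * real (word_prod w) \<in> {0<..1}"
      using p by (auto simp: luroth_cyl_def field_simps)
    moreover have "x = luroth_map w ((x - luroth_map w 0) * real (word_prod w))"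
      using p by (subst luroth_map_affine) simp
    ultimately show "x \<in> luroth_map w ` {0<..1}" by blast
  next
    fix x assume "x \<in> luroth_map w ` {0<..1}"
    then obtain y where "y \<in> {0<..1}" "x = luroth_map w 0 + y / real (word_prod w)"
      by (metis imageE luroth_map_affine)
    then show "x \<in> luroth_cyl w"
      using p by (auto simp: luroth_cyl_def divide_right_mono)
  qed
qed

lemma luroth_cyl_subset_unit: "set w \<subseteq> {2..} \<Longrightarrow> luroth_cyl w \<subseteq> {0<..1}"
  using luroth_map_in_unit by (auto simp: luroth_cyl_eq_image)

lemma measure_luroth_cyl: "measure lborel (luroth_cyl w) = 1 / real (word_prod w)"
  by (simp add: luroth_cyl_def)

lemma luroth_branch_eq_iff:
  assumes "2 \<le> d" "2 \<le> d'" "y \<in> {0<..1}" "y' \<in> {0<..1}"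
  shows "luroth_branch d y = luroth_branch d' y' \<longleftrightarrow> d = d' \<and> y = y'"
proof
  assume eq: "luroth_branch d y = luroth_branch d' y'"
  have "d = d'"
    using luroth_first_digit_unique[OF assms(1) _ _ assms(2), of "luroth_branch d y"]
      luroth_branch_in[OF assms(1,3)] luroth_branch_in[OF assms(2,4)] eq by auto
  moreover have "y = y'"
    using eq assms(1) unfolding \<open>d = d'\<close> luroth_branch_def by simp
  ultimately show "d = d' \<and> y = y'" ..
qed simp

text \<open>The recursion stops at the first prefix \<open>w\<close> with \<open>word_prod w \<ge> Y\<close>; if \<open>k\<close> is
  at least \<open>log 2 Y\<close>, the depth bound \<open>k\<close> does not cut it short.\<close>

fun stopped_words :: "nat \<Rightarrow> nat \<Rightarrow> real \<Rightarrow> nat list set" where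
  "stopped_words M 0 Y = {[]}"
| "stopped_words M (Suc k) Y = (if Y \<le> 1 then {[]}
     else \<Union>d\<in>{2..M}. (#) d ` stopped_words M k (Y / (real d * real (d - 1))))"

lemma finite_stopped_words [simp]: "finite (stopped_words M k Y)"
  by (induction M k Y rule: stopped_words.induct) auto

lemma stopped_words_digits: "w \<in> stopped_words M k Y \<Longrightarrow> set w \<subseteq> {2..M}"
  by (induction M k Y arbitrary: w rule: stopped_words.induct) (fastforce split: if_splits)+

text \<open>A letter \<open>d\<close> divides the threshold by \<open>c = d (d - 1)\<close>. Since
  \<open>c \<ge> 2\<close>, the bound \<open>2 ^ k\<close> is inherited with \<open>k\<close>
  lowered by one; since \<open>c \<le> M^2\<close> and letters are added only while
  \<open>Y > 1\<close>, the overshoot stays below the factor \<open>M^2\<close>.\<close>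

lemma stopped_words_bounds:
  assumes "w \<in> stopped_words M k Y" "Y \<le> 2 ^ k" "1 \<le> real M ^ 2 * Y"
  shows "Y \<le> real (word_prod w)" "real (word_prod w) \<le> real M ^ 2 * Y"
proof -
  have "Y \<le> real (word_prod w) \<and> real (word_prod w) \<le> real M ^ 2 * Y"
    using assms
  proof (induction M k Y arbitrary: w rule: stopped_words.induct)
    case (1 M Y)
    then show ?case by simp
  next
    case (2 M k Y)
    show ?case
    proof (cases "Y \<le> 1")
      case True
      then show ?thesis using 2 by simp
    next
      case False
      then obtain d v where d: "d \<in> {2..M}" "w = d # v"
          "v \<in> stopped_words M k (Y / (real d * real (d - 1)))"
        using "2.prems"(1) by auto
      define c where "c = real d * real (d - 1)"
      have "2 * 1 \<le> c" unfolding c_def using d(1) by (intro mult_mono) auto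
      then have c: "2 \<le> c" by simp
      have "c \<le> real M * real M" unfolding c_def using d(1) by (intro mult_mono) auto
      then have "c \<le> real M ^ 2" by (simp add: power2_eq_square)
      moreover have "real M ^ 2 * 1 \<le> real M ^ 2 * Y" using False by (intro mult_left_mono) auto
      ultimately have "c \<le> real M ^ 2 * Y" by simp
      then have "1 \<le> real M ^ 2 * (Y / c)" using c by simp
      moreover have "Y / c \<le> 2 ^ k"
      proof -
        have "Y \<le> 2 ^ k * 2" using 2 by simp
        also have "\<dots> \<le> 2 ^ k * c" using c by (intro mult_left_mono) auto
        finally show ?thesis using c by (simp add: divide_simps)
      qed
      ultimately have "Y / c \<le> real (word_prod v) \<and> real (word_prod v) \<le> real M ^ 2 * (Y / c)"
        using "2.IH"[OF False d(1), of v] d(3) unfolding c_def by simp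
      moreover have "real (word_prod w) = c * real (word_prod v)"
        by (simp add: d(2) c_def)
      ultimately show ?thesis using c by (simp add: field_simps)
    qed
  qed
  then show "Y \<le> real (word_prod w)" "real (word_prod w) \<le> real M ^ 2 * Y" by auto
qed

text \<open>Stopping makes the words prefix-free: two of them first differ at a letter that both
  possess, and branches for different digits have disjoint images.\<close>

lemma stopped_words_disjoint:
  assumes "w \<in> stopped_words M k Y" "w' \<in> stopped_words M k Y" "w \<noteq> w'"
  shows "luroth_cyl w \<inter> luroth_cyl w' = {}"
proof -
  have "luroth_map w y \<noteq> luroth_map w' y'" if "y \<in> {0<..1}" "y' \<in> {0<..1}" for y y'
    using assms
  proof (induction M k Y arbitrary: w w' rule: stopped_words.induct)
    case (1 M Y)
    then show ?case by simp
  next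
    case (2 M k Y)
    show ?case
    proof (cases "Y \<le> 1")
      case True
      then show ?thesis using 2 by simp
    next
      case False
      then obtain d v where d: "d \<in> {2..M}" "w = d # v"
          "v \<in> stopped_words M k (Y / (real d * real (d - 1)))"
        using "2.prems"(1) by auto
      from False obtain d' v' where d': "d' \<in> {2..M}" "w' = d' # v'"
          "v' \<in> stopped_words M k (Y / (real d' * real (d' - 1)))"
        using "2.prems"(2) by auto
      have "set v \<subseteq> {2..}" "set v' \<subseteq> {2..}"
        using stopped_words_digits[OF d(3)] stopped_words_digits[OF d'(3)] by auto
      then have "luroth_map v y \<in> {0<..1}" "luroth_map v' y' \<in> {0<..1}"
        using that luroth_map_in_unit by blast+
      moreover have "luroth_map v y \<noteq> luroth_map v' y'" if "d = d'"
        using "2.IH"[OF False d(1), of v v'] d d' that "2.prems"(3) by auto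
      ultimately show ?thesis
        using d d' by (auto simp: luroth_branch_eq_iff)
    qed
  qed
  moreover have "set w \<subseteq> {2..}" "set w' \<subseteq> {2..}"
    using stopped_words_digits[OF assms(1)] stopped_words_digits[OF assms(2)] by auto
  ultimately show ?thesis by (auto simp: luroth_cyl_eq_image)
qed

text \<open>Each of the at most \<open>k\<close> levels keeps the fraction \<open>1 - 1 / M\<close>,
  the total length of the branches with digits up to \<open>M\<close>; the product is at least
  \<open>1 - k / M\<close>.\<close>

lemma stopped_words_sum:
  assumes "2 \<le> M"
  shows "1 - real k / real M \<le> (\<Sum>w\<in>stopped_words M k Y. 1 / real (word_prod w))"
  using assms
proof (induction M k Y rule: stopped_words.induct)
  case (1 M Y)
  then show ?case by simp
next
  case (2 M k Y)
  show ?case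
  proof (cases "Y \<le> 1")
    case False
    let ?c = "\<lambda>d. real d * real (d - 1)"
    let ?S = "\<lambda>d. stopped_words M k (Y / ?c d)"
    have "(\<Sum>w\<in>stopped_words M (Suc k) Y. 1 / real (word_prod w))
        = (\<Sum>d = 2..M. \<Sum>w\<in>(#) d ` ?S d. 1 / real (word_prod w))"
      using False by (simp del: of_nat_mult) (intro sum.UNION_disjoint; auto)
    also have "\<dots> = (\<Sum>d = 2..M. 1 / ?c d * (\<Sum>w\<in>?S d. 1 / real (word_prod w)))"
      by (simp add: sum.reindex sum_distrib_left mult_ac)
    also have "\<dots> \<ge> (\<Sum>d = 2..M. 1 / ?c d * (1 - real k / real M))"
      using 2 False by (intro sum_mono mult_left_mono) auto
    also have "(\<Sum>d = 2..M. 1 / ?c d * (1 - real k / real M)) = (1 - 1 / real M) * (1 - real k / real M)"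
      using luroth_digit_sum[OF "2.prems"] unfolding sum_distrib_right[symmetric] by simp
    also have "\<dots> = 1 - real (Suc k) / real M + real k / (real M * real M)"
      using "2.prems" by (simp add: field_simps)
    finally show ?thesis
      by (smt (verit) divide_nonneg_nonneg mult_nonneg_nonneg of_nat_0_le_iff)
  qed simp
qed

text \<open>The cylinders have length at most \<open>1 / Y\<close>, so those meeting the interval
  shortened by \<open>1 / Y\<close> at both ends lie inside \<open>{a..b}\<close>. The rest of the
  loss is the part of (0,1] that no stopped word reaches.\<close>

lemma stopped_words_sum_interval:
  assumes M: "2 \<le> M" and Y: "0 < Y" "Y \<le> 2 ^ k" "1 \<le> real M ^ 2 * Y" and ab: "0 \<le> a" "b \<le> 1"
  shows "b - a - 2 / Y - real k / real M
    \<le> (\<Sum>w | w \<in> stopped_words M k Y \<and> luroth_cyl w \<subseteq> {a..b}. 1 / real (word_prod w))"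
proof (cases "a + 1 / Y \<le> b - 1 / Y")
  case True
  let ?F = "stopped_words M k Y"
  let ?G = "{w \<in> ?F. luroth_cyl w \<subseteq> {a..b}}"
  let ?J = "{a + 1 / Y<..b - 1 / Y}"
  let ?m = "measure lborel"
  have meas: "luroth_cyl w \<in> fmeasurable lborel" for w
    by (simp add: luroth_cyl_def fmeasurable_def)
  have disj: "disjoint_family_on luroth_cyl ?F"
    using stopped_words_disjoint by (auto simp: disjoint_family_on_def)
  have UF: "?m (\<Union>w\<in>A. luroth_cyl w) = (\<Sum>w\<in>A. 1 / real (word_prod w))" if "A \<subseteq> ?F" for A
  proof -
    have "finite A" using finite_subset[OF that] by simp
    then have "?m (\<Union>w\<in>A. luroth_cyl w) = (\<Sum>w\<in>A. ?m (luroth_cyl w))"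
      using meas disj that
      by (intro measure_finite_Union) (auto simp: fmeasurable_def less_top[symmetric] intro: disjoint_family_on_mono)
    then show ?thesis by (simp add: measure_luroth_cyl)
  qed
  have G: "w \<in> ?G" if "w \<in> ?F" "x \<in> luroth_cyl w" "x \<in> ?J" for w x
  proof -
    have "1 / real (word_prod w) \<le> 1 / Y"
      using stopped_words_bounds(1)[OF that(1) Y(2,3)] Y(1) by (intro divide_left_mono) auto
    then show ?thesis using that by (auto simp: luroth_cyl_def)
  qed
  have UG: "(\<Union>w\<in>?G. luroth_cyl w) \<in> fmeasurable lborel"
    using meas by (intro fmeasurable.finite_UN) auto
  have UFm: "(\<Union>w\<in>?F. luroth_cyl w) \<in> fmeasurable lborel"
    using meas by (intro fmeasurable.finite_UN) auto
  have sub: "?J \<subseteq> {0<..1}"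
    using ab Y(1) by (auto intro: less_le_trans add_nonneg_pos order_trans)
      (smt (verit) divide_pos_pos)+
  \<comment> \<open>A point of \<open>?J\<close> lies in a cylinder of \<open>?G\<close> or in no
    cylinder of \<open>?F\<close>; the points of the latter kind in (0,1] have measure at most
    \<open>k / M\<close>.\<close>
  have "?m ?J \<le> ?m ((\<Union>w\<in>?G. luroth_cyl w) \<union> ({0<..1} - (\<Union>w\<in>?F. luroth_cyl w)))"
  proof (rule measure_mono_fmeasurable)
    show "?J \<subseteq> (\<Union>w\<in>?G. luroth_cyl w) \<union> ({0<..1} - (\<Union>w\<in>?F. luroth_cyl w))"
      using G sub by blast
    show "?J \<in> sets lborel" by simp
    show "(\<Union>w\<in>?G. luroth_cyl w) \<union> ({0<..1} - (\<Union>w\<in>?F. luroth_cyl w)) \<in> fmeasurable lborel"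
      using UG UFm by (intro fmeasurable.Un fmeasurable.Diff) (auto simp: fmeasurable_def)
  qed
  also have "\<dots> \<le> ?m (\<Union>w\<in>?G. luroth_cyl w) + ?m ({0<..1} - (\<Union>w\<in>?F. luroth_cyl w))"
    using UG UFm by (intro measure_Un_le) (auto simp: fmeasurable_def)
  also have "?m ({0<..1} - (\<Union>w\<in>?F. luroth_cyl w)) = ?m {0<..1::real} - ?m (\<Union>w\<in>?F. luroth_cyl w)"
  proof (rule measure_Diff)
    show "(\<Union>w\<in>?F. luroth_cyl w) \<subseteq> {0<..1}"
      using luroth_cyl_subset_unit stopped_words_digits by fastforce
  qed (use UFm in \<open>auto simp: fmeasurable_def\<close>)
  finally have "?m ?J \<le> (\<Sum>w\<in>?G. 1 / real (word_prod w)) + 1 - (\<Sum>w\<in>?F. 1 / real (word_prod w))"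
    by (simp add: UF)
  moreover have "?m ?J = b - a - 2 / Y" using True by simp
  ultimately show ?thesis using stopped_words_sum[OF M, of k Y] by simp
next
  case False
  then have "b - a - 2 / Y - real k / real M \<le> 0"
    by (smt (verit) divide_nonneg_nonneg of_nat_0_le_iff field_sum_of_halves add_divide_distrib)
  also have "0 \<le> (\<Sum>w | w \<in> stopped_words M k Y \<and> luroth_cyl w \<subseteq> {a..b}. 1 / real (word_prod w))"
    by (intro sum_nonneg) auto
  finally show ?thesis .
qed

section \<open>Lightly hit intervals\<close>


text \<open>The share of the weight of the cover that falls on sets meeting \<open>A\<close>, the
  quantity kept small along the nested intervals. It is a real \<open>suminf\<close>, hence used
  with summable \<open>v\<close>.\<close>

definition hit_sum :: "(nat \<Rightarrow> 'a set) \<Rightarrow> (nat \<Rightarrow> real) \<Rightarrow> 'a set \<Rightarrow> real" where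
  "hit_sum U v A = (\<Sum>j. if U j \<inter> A \<noteq> {} then v j else 0)"

lemma hit_summable:
  assumes "summable v" "\<And>j. 0 \<le> v j"
  shows "summable (\<lambda>j. if P j then v j else (0::real))"
  by (rule summable_comparison_test'[OF assms(1), of 0]) (use assms(2) in auto)

lemma sum_le_hit_sum:
  assumes "summable v" "\<And>j. 0 \<le> v j" "finite J" "\<And>j. j \<in> J \<Longrightarrow> U j \<inter> A \<noteq> {}"
  shows "(\<Sum>j\<in>J. v j) \<le> hit_sum U v A"
proof -
  have "(\<Sum>j\<in>J. v j) = (\<Sum>j\<in>J. if U j \<inter> A \<noteq> {} then v j else 0)"
    using assms(4) by (intro sum.cong) auto
  also have "\<dots> \<le> hit_sum U v A"
    unfolding hit_sum_def by (intro sum_le_suminf hit_summable assms) (use assms(2) in auto)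
  finally show ?thesis .
qed

text \<open>After interchanging the sums, each \<open>v j\<close> is counted at most once, by
  \<open>once\<close>, and only if \<open>U j\<close> meets \<open>A\<close>.\<close>

lemma sum_hit_sum_le:
  assumes v: "summable v" "\<And>j. 0 \<le> v j" and F: "finite F" "\<And>w. w \<in> F \<Longrightarrow> K w \<subseteq> A"
    and once: "\<And>j w w'. w \<in> F \<Longrightarrow> w' \<in> F \<Longrightarrow> U j \<inter> K w \<noteq> {} \<Longrightarrow> U j \<inter> K w' \<noteq> {} \<Longrightarrow> w = w'"
  shows "(\<Sum>w\<in>F. hit_sum U v (K w)) \<le> hit_sum U v A"
proof -
  have "(\<Sum>w\<in>F. hit_sum U v (K w)) = (\<Sum>j. \<Sum>w\<in>F. if U j \<inter> K w \<noteq> {} then v j else 0)"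
    unfolding hit_sum_def by (intro suminf_sum[symmetric] hit_summable v)
  also have "\<dots> \<le> hit_sum U v A"
    unfolding hit_sum_def
  proof (intro suminf_le summable_sum hit_summable v)
    fix j
    show "(\<Sum>w\<in>F. if U j \<inter> K w \<noteq> {} then v j else 0) \<le> (if U j \<inter> A \<noteq> {} then v j else 0)"
    proof (cases "\<exists>w\<in>F. U j \<inter> K w \<noteq> {}")
      case True
      then obtain w where w: "w \<in> F" "U j \<inter> K w \<noteq> {}" by blast
      have "(\<Sum>w'\<in>F. if U j \<inter> K w' \<noteq> {} then v j else 0) = (\<Sum>w'\<in>F. if w' = w then v j else 0)"
      proof (rule sum.cong[OF refl])
        fix w' assume "w' \<in> F"
        then have "U j \<inter> K w' \<noteq> {} \<longleftrightarrow> w' = w" using once w by blast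
        then show "(if U j \<inter> K w' \<noteq> {} then v j else 0) = (if w' = w then v j else 0)" by simp
      qed
      then show ?thesis using w F by (auto simp: sum.delta)
    next
      case False
      then have "(\<Sum>w\<in>F. if U j \<inter> K w \<noteq> {} then v j else 0) = 0"
        by (intro sum.neutral) auto
      then show ?thesis using v(2)[of j] by simp
    qed
  qed
  finally show ?thesis .
qed

text \<open>A set meeting two of the middle parts \<open>K w\<close> covers at least a quarter of the interval of
  each part that it meets.\<close>

lemma sum_lengths_le_of_multiple_hits:
  fixes \<alpha> L :: "'w \<Rightarrow> real" and V :: "real set"
  assumes V: "\<And>x y. x \<in> V \<Longrightarrow> y \<in> V \<Longrightarrow> \<bar>x - y\<bar> \<le> u" and u: "0 \<le> u"
    and H: "finite H" "H \<subseteq> G"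
    and disj: "\<And>w w'. w \<in> G \<Longrightarrow> w' \<in> G \<Longrightarrow> w \<noteq> w' \<Longrightarrow>
      {\<alpha> w<..\<alpha> w + L w} \<inter> {\<alpha> w'<..\<alpha> w' + L w'} = {}"
    and L: "\<And>w. w \<in> G \<Longrightarrow> 0 < L w"
    and K: "\<And>w. w \<in> G \<Longrightarrow> K w \<subseteq> {\<alpha> w + L w / 2..\<alpha> w + 3 / 4 * L w}"
    and hits: "\<And>w. w \<in> H \<Longrightarrow> V \<inter> K w \<noteq> {}" "\<And>w. w \<in> H \<Longrightarrow> \<exists>w'\<in>G. w' \<noteq> w \<and> V \<inter> K w' \<noteq> {}"
  shows "(\<Sum>w\<in>H. L w) \<le> 8 * u"
proof (cases "H = {}")
  case False
  then obtain z where z: "z \<in> V" using hits(1) by blast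
  \<comment> \<open>The window \<open>?h\<close> contains \<open>V\<close> and has length
    \<open>2 * u\<close>; as a quarter of each \<open>L w\<close> fits into it disjointly, the
    constant is \<open>8 = 4 * 2\<close>.\<close>
  let ?C = "\<lambda>w. {\<alpha> w<..\<alpha> w + L w}" and ?h = "{z - u..z + u}"
  have h: "x \<in> ?h" if "x \<in> V" for x using V[OF z that] by auto
  have meas: "?C w \<inter> ?h \<in> fmeasurable lborel" for w
  proof (rule fmeasurableI2)
    show "?h \<in> fmeasurable lborel" using u by (simp add: fmeasurable_def)
  qed auto
  have "L w / 4 \<le> measure lborel (?C w \<inter> ?h)" if w: "w \<in> H" for w
  proof -
    have wG: "w \<in> G" and Lw: "0 < L w" using w H L by auto
    obtain x where x: "x \<in> V" "x \<in> K w" using hits(1)[OF w] by blast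
    obtain w' y where y: "w' \<in> G" "w' \<noteq> w" "y \<in> V" "y \<in> K w'" using hits(2)[OF w] by blast
    have "y \<in> {\<alpha> w' + L w' / 2..\<alpha> w' + 3 / 4 * L w'}" using K[OF y(1)] y(4) by blast
    then have "y \<in> ?C w'" using L[OF y(1)] by auto
    then have "y \<notin> ?C w" using disj[OF wG y(1)] y(2) by auto
    then consider "y \<le> \<alpha> w" | "\<alpha> w + L w < y" by fastforce
    \<comment> \<open>\<open>?h\<close> contains a point of the middle part and a point outside
      \<open>?C w\<close>, hence everything between them: the left half or the last quarter of
      \<open>?C w\<close>.\<close>
    then have "\<exists>p q. p \<le> q \<and> L w / 4 \<le> q - p \<and> {p<..q} \<subseteq> ?C w \<inter> ?h"
    proof cases
      case 1
      have "{\<alpha> w<..\<alpha> w + L w / 2} \<subseteq> ?C w \<inter> ?h"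
        using h[OF x(1)] h[OF y(3)] 1 K[OF wG] x(2) Lw by fastforce
      then show ?thesis using Lw by (intro exI[of _ "\<alpha> w"] exI[of _ "\<alpha> w + L w / 2"]) auto
    next
      case 2
      have "{\<alpha> w + 3 / 4 * L w<..\<alpha> w + L w} \<subseteq> ?C w \<inter> ?h"
        using h[OF x(1)] h[OF y(3)] 2 K[OF wG] x(2) Lw by fastforce
      then show ?thesis using Lw
        by (intro exI[of _ "\<alpha> w + 3 / 4 * L w"] exI[of _ "\<alpha> w + L w"]) auto
    qed
    then obtain p q where pq: "p \<le> q" "L w / 4 \<le> q - p" "{p<..q} \<subseteq> ?C w \<inter> ?h" by blast
    have "q - p = measure lborel {p<..q}" using pq(1) by simp
    also have "\<dots> \<le> measure lborel (?C w \<inter> ?h)"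
      using pq(3) meas by (intro measure_mono_fmeasurable) auto
    finally show ?thesis using pq(2) by simp
  qed
  then have "(\<Sum>w\<in>H. L w / 4) \<le> (\<Sum>w\<in>H. measure lborel (?C w \<inter> ?h))" by (rule sum_mono)
  also have "\<dots> = measure lborel (\<Union>w\<in>H. ?C w \<inter> ?h)"
  proof (rule measure_finite_Union[symmetric])
    show "disjoint_family_on (\<lambda>w. ?C w \<inter> ?h) H"
      unfolding disjoint_family_on_def using disj H(2) by blast
    show "emeasure lborel (?C w \<inter> ?h) \<noteq> \<infinity>" if "w \<in> H" for w
      using meas[of w] by (auto simp: fmeasurable_def)
  qed (use H in auto)
  also have "\<dots> \<le> measure lborel ?h"
    using H(1) u by (intro measure_mono_fmeasurable) (auto simp: fmeasurable_def)
  finally show ?thesis using u by (simp add: sum_divide_distrib[symmetric])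
qed (use u in simp)

text \<open>Every \<open>u j\<close> is at most \<open>\<eta>\<close>, so
  \<open>u j = u j powr t * u j powr (1 - t)\<close> is at most
  \<open>u j powr t * \<eta> powr (1 - t)\<close>; then sum over \<open>j\<close>.\<close>

lemma sum_le_of_sum_powr_le:
  fixes u :: "'a \<Rightarrow> real"
  assumes "0 < t" "t \<le> 1" "finite J" "\<And>j. j \<in> J \<Longrightarrow> 0 < u j" "0 < \<eta>"
    "(\<Sum>j\<in>J. u j powr t) \<le> \<eta> powr t"
  shows "(\<Sum>j\<in>J. u j) \<le> \<eta>"
proof -
  have "u j \<le> u j powr t * \<eta> powr (1 - t)" if j: "j \<in> J" for j
  proof -
    have "u j powr t \<le> (\<Sum>j\<in>J. u j powr t)" using j assms(3) by (intro member_le_sum) auto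
    then have "u j powr t \<le> \<eta> powr t" using assms(6) by linarith
    then have "u j \<le> \<eta>"
      using assms(1,4,5) j powr_less_mono2[of t \<eta> "u j"] by force
    then have "u j powr (1 - t) \<le> \<eta> powr (1 - t)"
      using assms(2,4) j by (intro powr_mono2) (auto simp: less_imp_le)
    then have "u j powr t * u j powr (1 - t) \<le> u j powr t * \<eta> powr (1 - t)"
      by (intro mult_left_mono) auto
    then show ?thesis using assms(4)[OF j] by (simp add: powr_add[symmetric])
  qed
  then have "(\<Sum>j\<in>J. u j) \<le> (\<Sum>j\<in>J. u j powr t) * \<eta> powr (1 - t)"
    unfolding sum_distrib_right by (rule sum_mono)
  also have "\<dots> \<le> \<eta> powr t * \<eta> powr (1 - t)" using assms(6) by (intro mult_right_mono) auto
  also have "\<dots> = \<eta>" using assms(5) by (simp add: powr_add[symmetric])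
  finally show ?thesis .
qed

text \<open>Parts sharing a \<open>U j\<close> with another part have total length at most
  \<open>8 * (b - a) / 32\<close>, half of what \<open>total\<close> provides; this fixes the
  constant 32. At least \<open>Y * (b - a) / 4\<close> parts remain, and no \<open>U j\<close> meets
  two of them, so if all were heavy, \<open>size\<close> would contradict
  \<open>light\<close>.\<close>

lemma exists_lightly_hit_part:
  fixes U :: "nat \<Rightarrow> real set" and \<alpha> L :: "'w \<Rightarrow> real"
  assumes t: "0 < t" "t \<le> 1"
    and U: "\<And>j x y. x \<in> U j \<Longrightarrow> y \<in> U j \<Longrightarrow> \<bar>x - y\<bar> \<le> u j"
    and u: "\<And>j. 0 < u j" "summable (\<lambda>j. u j powr t)"
    and ab: "a < b" and r: "0 < r" and Y: "0 < Y"
    and G: "finite G"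
    and disj: "\<And>w w'. w \<in> G \<Longrightarrow> w' \<in> G \<Longrightarrow> w \<noteq> w' \<Longrightarrow>
      {\<alpha> w<..\<alpha> w + L w} \<inter> {\<alpha> w'<..\<alpha> w' + L w'} = {}"
    and sub: "\<And>w. w \<in> G \<Longrightarrow> {\<alpha> w<..\<alpha> w + L w} \<subseteq> {a..b}"
    and L: "\<And>w. w \<in> G \<Longrightarrow> 0 < L w" "\<And>w. w \<in> G \<Longrightarrow> L w \<le> 1 / Y"
    and K: "\<And>w. w \<in> G \<Longrightarrow> K w \<subseteq> {\<alpha> w + L w / 2..\<alpha> w + 3 / 4 * L w}"
    and total: "(b - a) / 2 \<le> (\<Sum>w\<in>G. L w)"
    and light: "hit_sum U (\<lambda>j. u j powr t) {a..b} < ((b - a) / 32) powr t"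
    and size: "4 * (b - a) powr t \<le> Y * (b - a) * r powr t"
  shows "\<exists>w\<in>G. hit_sum U (\<lambda>j. u j powr t) (K w) < (r / 32) powr t"
proof (rule ccontr)
  let ?S = "hit_sum U (\<lambda>j. u j powr t)"
  assume "\<not> (\<exists>w\<in>G. ?S (K w) < (r / 32) powr t)"
  then have heavy: "(r / 32) powr t \<le> ?S (K w)" if "w \<in> G" for w using that by force
  have Kab: "K w \<subseteq> {a..b}" if "w \<in> G" for w
    using K[OF that] sub[OF that] L(1)[OF that] by (force simp: subset_iff)
  \<comment> \<open>\<open>B\<close> collects the spoiled parts; \<open>J\<close> below picks one
    responsible set for each, so that their lengths can be grouped by that set.\<close>
  define B where "B = {w \<in> G. \<exists>j. U j \<inter> K w \<noteq> {} \<and> (\<exists>w'\<in>G. w' \<noteq> w \<and> U j \<inter> K w' \<noteq> {})}"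
  have B: "finite B" "B \<subseteq> G" using G by (auto simp: B_def)
  have "\<forall>w\<in>B. \<exists>j. U j \<inter> K w \<noteq> {} \<and> (\<exists>w'\<in>G. w' \<noteq> w \<and> U j \<inter> K w' \<noteq> {})"
    by (auto simp: B_def)
  then obtain J where J: "\<And>w. w \<in> B \<Longrightarrow> U (J w) \<inter> K w \<noteq> {}"
      "\<And>w. w \<in> B \<Longrightarrow> \<exists>w'\<in>G. w' \<noteq> w \<and> U (J w) \<inter> K w' \<noteq> {}"
    by metis
  have "(\<Sum>w\<in>B. L w) = (\<Sum>j\<in>J ` B. \<Sum>w | w \<in> B \<and> J w = j. L w)"
    using B(1) by (rule sum.image_gen)
  also have "\<dots> \<le> (\<Sum>j\<in>J ` B. 8 * u j)"
  proof (rule sum_mono)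
    fix j assume "j \<in> J ` B"
    show "(\<Sum>w | w \<in> B \<and> J w = j. L w) \<le> 8 * u j"
      by (rule sum_lengths_le_of_multiple_hits[where V = "U j" and G = G and \<alpha> = \<alpha> and K = K])
        (use U u B disj L(1) K J in \<open>auto simp: less_imp_le\<close>)
  qed
  also have "\<dots> = 8 * (\<Sum>j\<in>J ` B. u j)" by (simp add: sum_distrib_left)
  also have "(\<Sum>j\<in>J ` B. u j) \<le> (b - a) / 32"
  proof (rule sum_le_of_sum_powr_le[OF t])
    have "(\<Sum>j\<in>J ` B. u j powr t) \<le> ?S {a..b}"
      using B J(1) Kab by (intro sum_le_hit_sum u) (auto, blast)
    then show "(\<Sum>j\<in>J ` B. u j powr t) \<le> ((b - a) / 32) powr t" using light by simp
  qed (use ab u B in auto)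
  finally have LB: "(\<Sum>w\<in>B. L w) \<le> (b - a) / 4" by simp
  have "(b - a) / 4 \<le> (\<Sum>w\<in>G - B. L w)"
    using total LB sum_diff[OF G B(2), of L] by simp
  also have "\<dots> \<le> (\<Sum>w\<in>G - B. 1 / Y)" using L(2) by (intro sum_mono) auto
  finally have "(b - a) / 4 \<le> real (card (G - B)) / Y" by simp
  then have card: "Y * (b - a) / 4 \<le> real (card (G - B))" using Y by (simp add: field_simps)
  have "Y * (b - a) / 4 * (r / 32) powr t \<le> real (card (G - B)) * (r / 32) powr t"
    using card by (intro mult_right_mono) auto
  also have "\<dots> = (\<Sum>w\<in>G - B. (r / 32) powr t)" by simp
  also have "\<dots> \<le> (\<Sum>w\<in>G - B. ?S (K w))" using heavy by (intro sum_mono) auto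
  also have "\<dots> \<le> ?S {a..b}"
  proof (rule sum_hit_sum_le)
    fix j w w' assume "w \<in> G - B" "w' \<in> G - B" "U j \<inter> K w \<noteq> {}" "U j \<inter> K w' \<noteq> {}"
    then show "w = w'" unfolding B_def by blast
  qed (use u G Kab in auto)
  also have "\<dots> < ((b - a) / 32) powr t" by (rule light)
  finally have "Y * (b - a) / 4 * r powr t / 32 powr t < (b - a) powr t / 32 powr t"
    using r ab by (simp add: powr_divide)
  then have "Y * (b - a) / 4 * r powr t < (b - a) powr t"
    by (simp only: divide_less_cancel) (auto split: if_splits)
  then show False using size by simp
qed

section \<open>Lower bound\<close>


text \<open>Used at \<open>x = X\<close> with \<open>M\<close> about
  \<open>X powr (\<epsilon> / 4)\<close>, \<open>Y = X powr (1 - \<epsilon>)\<close> and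
  \<open>k\<close> about \<open>log 2 X\<close>. The conditions say in turn that
  \<open>X \<ge> 1\<close>, that \<open>M \<ge> 2\<close>, that \<open>2 * M^2 * Y \<le> X\<close>,
  that the loss \<open>2 / Y + k / M\<close> is small, that the averaging inequality holds, and that
  the denominators are at least \<open>N\<close>.\<close>

lemma eventually_scale_conditions:
  fixes \<epsilon> c C N :: real
  assumes "0 < \<epsilon>" "\<epsilon> < 1" "0 < c"
  shows "\<forall>\<^sub>F x in at_top. 1 \<le> x \<and> 2 \<le> x powr (\<epsilon> / 4) - 1 \<and> 2 * x powr (1 - \<epsilon> / 2) \<le> x \<and>
    2 / x powr (1 - \<epsilon>) + (log 2 x + 1) / (x powr (\<epsilon> / 4) - 1) \<le> c \<and>
    C \<le> x powr \<epsilon> \<and> N \<le> x powr (1 - \<epsilon>)"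
proof -
  have "((\<lambda>x. 2 / x powr (1 - \<epsilon>) + (log 2 x + 1) / (x powr (\<epsilon> / 4) - 1)) \<longlongrightarrow> 0) at_top"
  proof (rule tendsto_add_zero)
    show "((\<lambda>x. 2 / x powr (1 - \<epsilon>)) \<longlongrightarrow> 0) at_top"
      using assms by real_asymp
    show "((\<lambda>x. (log 2 x + 1) / (x powr (\<epsilon> / 4) - 1)) \<longlongrightarrow> 0) at_top"
      using assms by real_asymp
  qed
  then have "\<forall>\<^sub>F x in at_top. 2 / x powr (1 - \<epsilon>) + (log 2 x + 1) / (x powr (\<epsilon> / 4) - 1) < c"
    using assms(3) by (rule order_tendstoD)
  moreover have "\<forall>\<^sub>F x in at_top. 2 \<le> x powr (\<epsilon> / 4) - 1" using assms by real_asymp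
  moreover have "\<forall>\<^sub>F x in at_top. 2 * x powr (1 - \<epsilon> / 2) \<le> x" using assms by real_asymp
  moreover have "filterlim (\<lambda>x::real. x powr \<epsilon>) at_top at_top" using assms by real_asymp
  then have "\<forall>\<^sub>F x in at_top. C \<le> x powr \<epsilon>" by (simp add: filterlim_at_top)
  moreover have "filterlim (\<lambda>x::real. x powr (1 - \<epsilon>)) at_top at_top" using assms by real_asymp
  then have "\<forall>\<^sub>F x in at_top. N \<le> x powr (1 - \<epsilon>)" by (simp add: filterlim_at_top)
  moreover have "\<forall>\<^sub>F x in at_top. (1::real) \<le> x" by (rule eventually_ge_at_top)
  ultimately show ?thesis by eventually_elim auto
qed

text \<open>The branch of the digit 2 covers the right half of (0,1], so a point slightly to the
  right of the midpoint of a cylinder has next digit 2, and the midpoint is its convergent.\<close>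

lemma luroth_near_midpoint:
  assumes w: "set w \<subseteq> {2..}" and \<rho>: "0 < \<rho>" "\<rho> * real (word_prod w) \<le> 1"
    and x: "x - luroth_map w (1 / 2) \<in> {\<rho> / 4..\<rho> / 2}"
  shows "x \<in> {0<..1}" "luroth_Q (Suc (length w)) x = word_prod w * 2"
    "luroth_P (Suc (length w)) x / real (luroth_Q (Suc (length w)) x) = luroth_map w (1 / 2)"
proof -
  let ?p = "real (word_prod w)"
  have p: "0 < ?p" using word_prod_pos[OF w] by simp
  define y where "y = 2 * ((x - luroth_map w (1 / 2)) * ?p)"
  have "y \<le> 2 * (\<rho> / 2 * ?p)" unfolding y_def using x p by (intro mult_left_mono mult_right_mono) auto
  also have "\<dots> \<le> 1" using \<rho>(2) by simp
  finally have "y \<le> 1" .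
  moreover have "0 < y" unfolding y_def using x p \<rho>(1) by auto
  ultimately have y: "y \<in> {0<..1}" by simp
  have "luroth_map w (luroth_branch 2 y) = luroth_map w 0 + (1 / 2 + y / 2) / ?p"
    by (subst luroth_map_affine) (simp add: luroth_branch_def)
  also have "\<dots> = luroth_map w 0 + (1 / 2) / ?p + (x - luroth_map w (1 / 2))"
    using p by (simp add: y_def field_simps)
  also have "\<dots> = x" by (subst (2) luroth_map_affine) simp
  finally have eq: "luroth_map w (luroth_branch 2 y) = x" .
  show "luroth_Q (Suc (length w)) x = word_prod w * 2"
    "luroth_P (Suc (length w)) x / real (luroth_Q (Suc (length w)) x) = luroth_map w (1 / 2)"
    using luroth_map_Q_convergent[OF w _ y, of 2] unfolding eq by simp_all
  show "x \<in> {0<..1}"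
    using luroth_map_in_unit[OF w luroth_branch_in_unit[OF _ y, of 2]] unfolding eq by simp
qed

text \<open>One step of the nested construction: at a good scale \<open>X\<close>, the cylinders
  inside \<open>{c..e}\<close> supply candidate intervals next to their midpoints, and
  \<open>exists_lightly_hit_part\<close> selects one.\<close>

lemma luroth_refine_interval:
  fixes U :: "nat \<Rightarrow> real set"
  assumes psi: "\<And>q. 1 \<le> q \<Longrightarrow> 0 < \<psi> q \<and> \<psi> q \<le> 1"
    and mono: "\<And>p q. 1 \<le> p \<Longrightarrow> p \<le> q \<Longrightarrow> \<psi> q / real q \<le> \<psi> p / real p"
    and freq: "\<exists>\<^sub>F q in sequentially. real q powr - b \<le> \<psi> q"
    and t: "0 < t" "(1 + b) * t < 1" and b: "0 \<le> b"
    and U: "\<And>j x y. x \<in> U j \<Longrightarrow> y \<in> U j \<Longrightarrow> \<bar>x - y\<bar> \<le> u j"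
    and u: "\<And>j. 0 < u j" "summable (\<lambda>j. u j powr t)"
    and ce: "0 \<le> c" "c < e" "e \<le> 1"
    and light: "hit_sum U (\<lambda>j. u j powr t) {c..e} < ((e - c) / 32) powr t"
  shows "\<exists>c' e'. c \<le> c' \<and> 0 \<le> c' \<and> c' < e' \<and> e' \<le> e \<and> e' - c' \<le> 1 / real (Suc N) \<and>
    hit_sum U (\<lambda>j. u j powr t) {c'..e'} < ((e' - c') / 32) powr t \<and>
    (\<forall>x\<in>{c'..e'}. x \<in> {0<..1} \<and> (\<exists>n. N \<le> luroth_Q n x \<and>
      \<bar>x - luroth_P n x / real (luroth_Q n x)\<bar> < \<psi> (luroth_Q n x) / real (luroth_Q n x)))"
proof -
  \<comment> \<open>Chosen so that \<open>1 - \<epsilon> - (1 + b) * t = \<epsilon>\<close>, whence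
    \<open>Y * \<rho> powr t \<ge> X powr \<epsilon>\<close> below.\<close>
  define \<epsilon> where "\<epsilon> = (1 - (1 + b) * t) / 2"
  have "1 * t \<le> (1 + b) * t" using b t by (intro mult_right_mono) auto
  then have t1: "t \<le> 1" using t by linarith
  have "0 < (1 + b) * t" using b t by simp
  then have \<epsilon>: "0 < \<epsilon>" "\<epsilon> < 1" using t by (auto simp: \<epsilon>_def)
  define l where "l = e - c"
  have l: "0 < l" using ce by (simp add: l_def)
  \<comment> \<open>The inequality \<open>size\<close> amounts to
    \<open>C \<le> Y * \<rho> powr t\<close>. As \<open>C\<close> depends only on \<open>l\<close>
    and \<open>t\<close>, the scale \<open>X\<close> can be chosen after it.\<close>
  define C where "C = 4 * l powr t * 4 powr t / l"
  have "\<forall>\<^sub>F q in sequentially. 1 \<le> real q \<and> 2 \<le> real q powr (\<epsilon> / 4) - 1 \<and>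
      2 * real q powr (1 - \<epsilon> / 2) \<le> real q \<and>
      2 / real q powr (1 - \<epsilon>) + (log 2 (real q) + 1) / (real q powr (\<epsilon> / 4) - 1) \<le> l / 2 \<and>
      C \<le> real q powr \<epsilon> \<and> real (Suc N) \<le> real q powr (1 - \<epsilon>)"
    using eventually_compose_filterlim[OF eventually_scale_conditions[OF \<epsilon>] filterlim_real_sequentially,
      of "l / 2" C "real (Suc N)"] l by simp
  with freq have "\<exists>\<^sub>F q in sequentially. real q powr - b \<le> \<psi> q \<and> 1 \<le> real q \<and> 2 \<le> real q powr (\<epsilon> / 4) - 1 \<and>
      2 * real q powr (1 - \<epsilon> / 2) \<le> real q \<and>
      2 / real q powr (1 - \<epsilon>) + (log 2 (real q) + 1) / (real q powr (\<epsilon> / 4) - 1) \<le> l / 2 \<and>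
      C \<le> real q powr \<epsilon> \<and> real (Suc N) \<le> real q powr (1 - \<epsilon>)"
    by (rule frequently_eventually_frequently)
  then obtain X where X: "real X powr - b \<le> \<psi> X" "1 \<le> real X" "2 \<le> real X powr (\<epsilon> / 4) - 1"
      "2 * real X powr (1 - \<epsilon> / 2) \<le> real X"
      "2 / real X powr (1 - \<epsilon>) + (log 2 (real X) + 1) / (real X powr (\<epsilon> / 4) - 1) \<le> l / 2"
      "C \<le> real X powr \<epsilon>" "real (Suc N) \<le> real X powr (1 - \<epsilon>)"
    by (auto dest: frequently_ex)
  define M where "M = nat \<lfloor>real X powr (\<epsilon> / 4)\<rfloor>"
  define Y where "Y = real X powr (1 - \<epsilon>)"
  define k where "k = nat \<lceil>log 2 (real X)\<rceil>"
  \<comment> \<open>The precision at scale \<open>X\<close>; by \<open>mono\<close> it is admissible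
    for every denominator from 1 to \<open>X\<close>.\<close>
  define \<rho> where "\<rho> = \<psi> X / real X"
  define G where "G = {w \<in> stopped_words M k Y. luroth_cyl w \<subseteq> {c..e}}"
  have M: "real X powr (\<epsilon> / 4) - 1 \<le> real M" "real M \<le> real X powr (\<epsilon> / 4)" "2 \<le> M"
    using X(3) unfolding M_def by linarith+
  have Y1: "1 \<le> Y" unfolding Y_def using X(2) \<epsilon> by (intro ge_one_powr_ge_zero) auto
  have "real X = 2 powr log 2 (real X)" using X(2) by simp
  also have "\<dots> \<le> 2 powr real k" unfolding k_def using X(2) by (intro powr_mono) linarith+
  also have "\<dots> = 2 ^ k" by (simp add: powr_realpow)
  finally have Xk: "real X \<le> 2 ^ k" .
  have "Y \<le> real X powr 1" unfolding Y_def using X(2) \<epsilon> by (intro powr_mono) auto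
  then have YX: "Y \<le> real X" using X(2) by simp
  then have Yk: "Y \<le> 2 ^ k" using Xk by linarith
  have "1 * 1 \<le> real M ^ 2 * Y" using M(3) Y1 by (intro mult_mono) auto
  then have MY: "1 \<le> real M ^ 2 * Y" by simp
  have "real M ^ 2 * Y \<le> (real X powr (\<epsilon> / 4)) ^ 2 * Y"
    using M(2) Y1 by (intro mult_right_mono power_mono) auto
  also have "\<dots> = real X powr (1 - \<epsilon> / 2)"
    unfolding Y_def power2_eq_square by (simp add: powr_add[symmetric])
  finally have MYX: "2 * (real M ^ 2 * Y) \<le> real X" using X(4) by simp
  have \<rho>: "0 < \<rho>" "\<rho> \<le> 1 / real X"
    using psi[of X] X(2) unfolding \<rho>_def by (auto intro: divide_right_mono)
  have w2: "set w \<subseteq> {2..}" if "w \<in> G" for w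
    using stopped_words_digits[of w] that unfolding G_def by fastforce
  have wp: "Y \<le> real (word_prod w)" "2 * real (word_prod w) \<le> real X" if "w \<in> G" for w
    using stopped_words_bounds[OF _ Yk MY, of w] that MYX unfolding G_def by auto
  have p: "0 < real (word_prod w)" if "w \<in> G" for w using wp(1)[OF that] Y1 by linarith
  have \<rho>p: "2 * \<rho> * real (word_prod w) \<le> 1" if "w \<in> G" for w
  proof -
    have "2 * \<rho> * real (word_prod w) \<le> \<rho> * real X"
      using wp(2)[OF that] \<rho>(1) mult_left_mono[of "2 * real (word_prod w)" "real X" \<rho>] by simp
    also have "\<dots> \<le> 1" using \<rho>(2) X(2) by (simp add: field_simps)
    finally show ?thesis .
  qed
  let ?m = "\<lambda>w. luroth_map w (1 / 2)"
  \<comment> \<open>The interval has length \<open>\<rho> / 4\<close>, stays strictly within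
    \<open>\<rho>\<close> of the midpoint and, by the bound on
    \<open>2 * \<rho> * word_prod w\<close>, lies in the third quarter of the cylinder.\<close>
  let ?K = "\<lambda>w. {?m w + \<rho> / 4..?m w + \<rho> / 2}"
  have mid: "?m w = luroth_map w 0 + 1 / real (word_prod w) / 2" for w
    by (subst luroth_map_affine) simp
  have "real k \<le> log 2 (real X) + 1" unfolding k_def using X(2) by (simp add: zero_le_log_cancel_iff)
  then have "real k / real M \<le> (log 2 (real X) + 1) / (real X powr (\<epsilon> / 4) - 1)"
    using M X(2,3) by (intro frac_le) auto
  then have "2 / Y + real k / real M \<le> l / 2" using X(5) unfolding Y_def by linarith
  then have total: "(e - c) / 2 \<le> (\<Sum>w\<in>G. 1 / real (word_prod w))"
    using stopped_words_sum_interval[OF M(3) _ Yk MY ce(1,3)] Y1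
    unfolding G_def l_def by simp
  have size: "4 * (e - c) powr t \<le> Y * (e - c) * (\<rho> / 4) powr t"
  proof -
    have "real X powr (- b - 1) \<le> \<rho>"
      unfolding \<rho>_def using X(1,2) by (simp add: powr_diff divide_right_mono)
    then have "(real X powr (- b - 1)) powr t \<le> \<rho> powr t" using t by (intro powr_mono2) auto
    then have "Y * real X powr ((- b - 1) * t) \<le> Y * \<rho> powr t"
      using Y1 by (intro mult_left_mono) (auto simp: powr_powr)
    moreover have "Y * real X powr ((- b - 1) * t) = real X powr \<epsilon>"
    proof -
      have "1 - \<epsilon> + (- b - 1) * t = \<epsilon>" unfolding \<epsilon>_def by (simp add: field_simps)
      then show ?thesis unfolding Y_def powr_add[symmetric] by (simp only:)
    qed
    ultimately have "C \<le> Y * \<rho> powr t" using X(6) by linarith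
    then show ?thesis
      using l \<rho>(1) unfolding C_def l_def[symmetric] by (simp add: powr_divide field_simps)
  qed
  have "\<exists>w\<in>G. hit_sum U (\<lambda>j. u j powr t) (?K w) < ((\<rho> / 4) / 32) powr t"
  proof (rule exists_lightly_hit_part[OF t(1) t1 U u ce(2), where Y = Y and
        \<alpha> = "\<lambda>w. luroth_map w 0" and L = "\<lambda>w. 1 / real (word_prod w)"])
    show "finite G" by (simp add: G_def)
    fix w assume w: "w \<in> G"
    show "{luroth_map w 0<..luroth_map w 0 + 1 / real (word_prod w)} \<subseteq> {c..e}"
      using w unfolding G_def luroth_cyl_def by simp
    show "0 < 1 / real (word_prod w)" using p[OF w] by simp
    show "1 / real (word_prod w) \<le> 1 / Y" using wp(1)[OF w] Y1 by (intro divide_left_mono) auto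
    have "\<rho> / 2 \<le> 1 / real (word_prod w) / 4" using \<rho>p[OF w] p[OF w] by (simp add: field_simps)
    then show "?K w \<subseteq> {luroth_map w 0 + 1 / real (word_prod w) / 2..
        luroth_map w 0 + 3 / 4 * (1 / real (word_prod w))}"
      unfolding mid using \<rho>(1) by auto
    fix w' assume w': "w' \<in> G" "w \<noteq> w'"
    then show "{luroth_map w 0<..luroth_map w 0 + 1 / real (word_prod w)} \<inter>
        {luroth_map w' 0<..luroth_map w' 0 + 1 / real (word_prod w')} = {}"
      using stopped_words_disjoint[of w M k Y w'] w unfolding G_def luroth_cyl_def by simp
  qed (use \<rho> Y1 total light size in auto)
  then obtain w where w: "w \<in> G" "hit_sum U (\<lambda>j. u j powr t) (?K w) < ((\<rho> / 4) / 32) powr t"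
    by blast
  have near: "x \<in> {0<..1}" "luroth_Q (Suc (length w)) x = word_prod w * 2"
      "luroth_P (Suc (length w)) x / real (luroth_Q (Suc (length w)) x) = ?m w" if "x \<in> ?K w" for x
  proof -
    have "0 < \<rho> * real (word_prod w)" using \<rho>(1) p[OF w(1)] by (rule mult_pos_pos)
    then have "\<rho> * real (word_prod w) \<le> 1" using \<rho>p[OF w(1)] by linarith
    moreover have "x - ?m w \<in> {\<rho> / 4..\<rho> / 2}" using that by auto
    ultimately show "x \<in> {0<..1}" "luroth_Q (Suc (length w)) x = word_prod w * 2"
      "luroth_P (Suc (length w)) x / real (luroth_Q (Suc (length w)) x) = ?m w"
      using luroth_near_midpoint[OF w2[OF w(1)] \<rho>(1)] by blast+
  qed
  have cyl: "?K w \<subseteq> {c..e}"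
  proof -
    have "\<rho> / 2 \<le> 1 / real (word_prod w) / 2" using \<rho>p[OF w(1)] p[OF w(1)] \<rho>(1) by (simp add: field_simps)
    then have "?K w \<subseteq> luroth_cyl w" unfolding luroth_cyl_def mid using \<rho>(1) p[OF w(1)] by auto
    then show ?thesis using w(1) unfolding G_def by blast
  qed
  show ?thesis
  proof (rule exI[of _ "?m w + \<rho> / 4"], rule exI[of _ "?m w + \<rho> / 2"], intro conjI ballI)
    have in1: "?m w + \<rho> / 4 \<in> ?K w" "?m w + \<rho> / 2 \<in> ?K w" using \<rho>(1) by auto
    then show "c \<le> ?m w + \<rho> / 4" "?m w + \<rho> / 2 \<le> e" using cyl by auto
    show "0 \<le> ?m w + \<rho> / 4" using near(1)[OF in1(1)] by simp
    show "?m w + \<rho> / 4 < ?m w + \<rho> / 2" using \<rho>(1) by simp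
    have "real (Suc N) \<le> real X" using X(7) YX unfolding Y_def by linarith
    then have "1 / real X \<le> 1 / real (Suc N)" by (intro divide_left_mono) auto
    then show "?m w + \<rho> / 2 - (?m w + \<rho> / 4) \<le> 1 / real (Suc N)" using \<rho> by simp
    show "hit_sum U (\<lambda>j. u j powr t) (?K w) < ((?m w + \<rho> / 2 - (?m w + \<rho> / 4)) / 32) powr t"
      using w(2) by simp
    fix x assume x: "x \<in> ?K w"
    show "x \<in> {0<..1}" using near(1)[OF x] .
    show "\<exists>n. N \<le> luroth_Q n x \<and>
      \<bar>x - luroth_P n x / real (luroth_Q n x)\<bar> < \<psi> (luroth_Q n x) / real (luroth_Q n x)"
    proof (intro exI[of _ "Suc (length w)"] conjI)
      have "real N \<le> real (word_prod w * 2)"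
        using wp(1)[OF w(1)] X(7) p[OF w(1)] unfolding Y_def by simp
      then show "N \<le> luroth_Q (Suc (length w)) x" unfolding near(2)[OF x] by linarith
      have "1 \<le> word_prod w * 2" "word_prod w * 2 \<le> X" using wp(2)[OF w(1)] p[OF w(1)] by linarith+
      then have "\<rho> \<le> \<psi> (word_prod w * 2) / real (word_prod w * 2)"
        unfolding \<rho>_def by (rule mono)
      moreover have "\<bar>x - ?m w\<bar> < \<rho>" using x \<rho>(1) by auto
      ultimately show "\<bar>x - luroth_P (Suc (length w)) x / real (luroth_Q (Suc (length w)) x)\<bar>
          < \<psi> (luroth_Q (Suc (length w)) x) / real (luroth_Q (Suc (length w)) x)"
        using near(3)[OF x] unfolding near(2)[OF x] by simp
    qed
  qed
qed


text \<open>A cheap cover would leave room for a nested sequence of lightly hit intervals; a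
  \<open>U j\<close> containing their common point costs too much for the small ones among
  them.\<close>

lemma hausdorff_measure_luroth_L_neq_0:
  assumes psi: "\<And>q. 1 \<le> q \<Longrightarrow> 0 < \<psi> q \<and> \<psi> q \<le> 1"
    and mono: "\<And>p q. 1 \<le> p \<Longrightarrow> p \<le> q \<Longrightarrow> \<psi> q / real q \<le> \<psi> p / real p"
    and freq: "\<exists>\<^sub>F q in sequentially. real q powr - b \<le> \<psi> q"
    and t: "0 < t" "(1 + b) * t < 1" and b: "0 \<le> b"
  shows "hausdorff_measure t (luroth_L \<psi>) \<noteq> 0"
proof
  assume "hausdorff_measure t (luroth_L \<psi>) = 0"
  \<comment> \<open>Half of the budget \<open>(1 / 32) powr t\<close> of the unit interval; the
    other half pays for the correction in \<open>v\<close>.\<close>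
  define \<kappa> :: real where "\<kappa> = (1 / 32) powr t / 2"
  have \<kappa>: "0 < \<kappa>" by (simp add: \<kappa>_def)
  obtain U :: "nat \<Rightarrow> real set" where U: "luroth_L \<psi> \<subseteq> (\<Union>j. U j)" "\<And>j. bounded (U j)"
      "summable (\<lambda>j. diam_power t (U j))" "(\<Sum>j. diam_power t (U j)) < \<kappa>"
    by (rule hausdorff_measure_0_cover[OF \<open>hausdorff_measure t (luroth_L \<psi>) = 0\<close> \<kappa>], rule that)
  \<comment> \<open>The geometric term makes every weight positive, so that \<open>u j\<close> is a
    positive bound for the diameter even if \<open>U j\<close> is empty or a single point.\<close>
  define v where "v j = diam_power t (U j) + \<kappa> * (1 / 2) ^ Suc j" for j
  define u where "u j = v j powr (1 / t)" for j
  have v: "0 < v j" for j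
    using \<kappa> by (simp add: v_def diam_power_def add_nonneg_pos)
  have uv: "u j powr t = v j" for j
    using v[of j] t by (simp add: u_def powr_powr)
  have u: "0 < u j" for j using v[of j] by (simp add: u_def)
  have geo: "(\<lambda>j. \<kappa> * (1 / 2) ^ Suc j) sums (\<kappa> * 1)"
    using power_half_series by (intro sums_mult)
  have vsum: "summable v"
    unfolding v_def using U(3) geo by (intro summable_add) (auto simp: sums_iff)
  have "(\<Sum>j. v j) = (\<Sum>j. diam_power t (U j)) + \<kappa>"
    unfolding v_def using U(3) geo by (subst suminf_add[symmetric]) (auto simp: sums_iff)
  then have vtotal: "(\<Sum>j. v j) < (1 / 32) powr t" using U(4) by (simp add: \<kappa>_def)
  have dist: "\<bar>x - y\<bar> \<le> u j" if "x \<in> U j" "y \<in> U j" for x y j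
  proof -
    have d: "\<bar>x - y\<bar> \<le> diameter (U j)"
      using diameter_bounded_bound[OF U(2) that] by (simp add: dist_real_def)
    have "diameter (U j) powr t \<le> v j"
      using that t \<kappa> by (auto simp: v_def diam_power_def)
    then have "(diameter (U j) powr t) powr (1 / t) \<le> u j"
      unfolding u_def using t by (intro powr_mono2) auto
    then show ?thesis using d t by (simp add: powr_powr)
  qed
  let ?S = "hit_sum U (\<lambda>j. u j powr t)"
  let ?P = "\<lambda>I. 0 \<le> fst I \<and> fst I < snd I \<and> snd I \<le> 1 \<and> ?S {fst I..snd I} < ((snd I - fst I) / 32) powr t"
  let ?R = "\<lambda>N I I'. fst I \<le> fst I' \<and> snd I' \<le> snd I \<and> snd I' - fst I' \<le> 1 / real (Suc N) \<and>
    (\<forall>x\<in>{fst I'..snd I'}. x \<in> {0<..1} \<and> (\<exists>n. N \<le> luroth_Q n x \<and>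
      \<bar>x - luroth_P n x / real (luroth_Q n x)\<bar> < \<psi> (luroth_Q n x) / real (luroth_Q n x)))"
  have "\<exists>I. \<forall>n. ?P (I n) \<and> ?R n (I n) (I (Suc n))"
  proof (rule dependent_nat_choice[where P = "\<lambda>_. ?P" and Q = ?R])
    have "?S {0..1} \<le> (\<Sum>j. v j)"
      unfolding hit_sum_def uv using v vsum
      by (intro suminf_le hit_summable) (auto simp: less_imp_le)
    then have "?P (0, 1)" using vtotal by simp
    then show "\<exists>I. ?P I" ..
  next
    fix I n assume I: "?P I"
    have "\<exists>c' e'. fst I \<le> c' \<and> 0 \<le> c' \<and> c' < e' \<and> e' \<le> snd I \<and> e' - c' \<le> 1 / real (Suc n) \<and>
        ?S {c'..e'} < ((e' - c') / 32) powr t \<and>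
        (\<forall>x\<in>{c'..e'}. x \<in> {0<..1} \<and> (\<exists>m. n \<le> luroth_Q m x \<and>
          \<bar>x - luroth_P m x / real (luroth_Q m x)\<bar> < \<psi> (luroth_Q m x) / real (luroth_Q m x)))"
    proof (rule luroth_refine_interval[OF psi mono freq t b dist u])
      show "summable (\<lambda>j. u j powr t)" using vsum by (simp add: uv)
    qed (use I in simp_all)
    then obtain c' e' where "fst I \<le> c' \<and> 0 \<le> c' \<and> c' < e' \<and> e' \<le> snd I \<and> e' - c' \<le> 1 / real (Suc n) \<and>
        ?S {c'..e'} < ((e' - c') / 32) powr t \<and>
        (\<forall>x\<in>{c'..e'}. x \<in> {0<..1} \<and> (\<exists>m. n \<le> luroth_Q m x \<and>
          \<bar>x - luroth_P m x / real (luroth_Q m x)\<bar> < \<psi> (luroth_Q m x) / real (luroth_Q m x)))"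
      by (elim exE)
    then have "?P (c', e') \<and> ?R n I (c', e')" using I by simp
    then show "\<exists>I'. ?P I' \<and> ?R n I I'" ..
  qed
  then obtain I where P: "\<And>n. ?P (I n)" and R: "\<And>n. ?R n (I n) (I (Suc n))" by blast
  have inc: "incseq (\<lambda>n. fst (I n))" and dec: "decseq (\<lambda>n. snd (I n))"
    using R by (auto intro!: incseq_SucI decseq_SucI)
  have le: "fst (I m) \<le> snd (I n)" for m n
  proof -
    have "fst (I m) \<le> fst (I (max m n))" using inc by (auto simp: incseq_def)
    also have "\<dots> \<le> snd (I (max m n))" using P[of "max m n"] by simp
    also have "\<dots> \<le> snd (I n)" using dec by (auto simp: decseq_def)
    finally show ?thesis .
  qed
  obtain x where x: "(\<lambda>n. fst (I n)) \<longlonglongrightarrow> x" "\<And>n. fst (I n) \<le> x"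
    using incseq_convergent[OF inc, of "snd (I 0)"] le by blast
  have xI: "x \<in> {fst (I n)..snd (I n)}" for n
    using x(2) LIMSEQ_le_const2[OF x(1), of "snd (I n)"] le by auto
  have "x \<in> luroth_L \<psi>"
    unfolding mem_luroth_L_iff
  proof
    fix N
    \<comment> \<open>The refinement controls the size of Q_n and not the index \<open>n\<close>. A
      denominator above all those with index below \<open>N\<close> forces
      \<open>n \<ge> N\<close>.\<close>
    define B where "B = Max (insert 0 ((\<lambda>n. luroth_Q n x) ` {..<N}))"
    obtain n where n: "x \<in> {0<..1}" "Suc B \<le> luroth_Q n x"
        "\<bar>x - luroth_P n x / real (luroth_Q n x)\<bar> < \<psi> (luroth_Q n x) / real (luroth_Q n x)"
      using R[of "Suc B"] xI[of "Suc (Suc B)"] by blast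
    have "luroth_Q m x \<le> B" if "m < N" for m
      unfolding B_def using that by (intro Max_ge) auto
    then have "N \<le> n" using n(2) by (metis not_less not_less_eq_eq)
    then show "\<exists>n\<ge>N. x \<in> {0<..1} \<and>
        \<bar>x - luroth_P n x / real (luroth_Q n x)\<bar> < \<psi> (luroth_Q n x) / real (luroth_Q n x)"
      using n by blast
  qed
  then obtain j where j: "x \<in> U j" using U(1) by blast
  \<comment> \<open>An interval shorter than \<open>u j\<close> that still meets \<open>U j\<close>
    has hit sum at least \<open>u j powr t\<close>, too much to be lightly hit.\<close>
  obtain n where n: "inverse (real (Suc n)) < u j" using reals_Archimedean[OF u] by blast
  let ?l = "snd (I (Suc n)) - fst (I (Suc n))"
  have "(\<Sum>j\<in>{j}. u j powr t) \<le> ?S {fst (I (Suc n))..snd (I (Suc n))}"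
    using j xI[of "Suc n"] vsum v by (intro sum_le_hit_sum) (auto simp: uv less_imp_le)
  also have "\<dots> < (?l / 32) powr t" using P[of "Suc n"] by blast
  also have "\<dots> \<le> u j powr t"
    using P[of "Suc n"] R[of n] n t by (intro powr_mono2) (auto simp: inverse_eq_divide)
  finally show False by simp
qed

section \<open>From Hausdorff measures to the dimension\<close>

lemma hausdorff_measure_empty: "hausdorff_measure t {} = 0"
  by (rule hausdorff_measure_eq_0I[where B = "\<lambda>_::nat. {}"]) (auto intro!: exI[of _ "{}"])

lemma ereal_neg_log_ratio_less_iff:
  assumes "2 \<le> q" "0 < \<psi> q"
  shows "ereal (- ln (\<psi> q) / ln (real q)) < ereal b \<longleftrightarrow> real q powr - b < \<psi> q"
    "ereal b < ereal (- ln (\<psi> q) / ln (real q)) \<longleftrightarrow> \<psi> q < real q powr - b"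
proof -
  have q: "0 < ln (real q)" using assms by simp
  have "real q powr - b < \<psi> q \<longleftrightarrow> ln (real q powr - b) < ln (\<psi> q)"
    using assms by (subst ln_less_cancel_iff) auto
  then show "ereal (- ln (\<psi> q) / ln (real q)) < ereal b \<longleftrightarrow> real q powr - b < \<psi> q"
    using q assms by (simp add: ln_powr field_simps) linarith
  have "\<psi> q < real q powr - b \<longleftrightarrow> ln (\<psi> q) < ln (real q powr - b)"
    using assms by (subst ln_less_cancel_iff) auto
  then show "ereal b < ereal (- ln (\<psi> q) / ln (real q)) \<longleftrightarrow> \<psi> q < real q powr - b"
    using q assms by (simp add: ln_powr field_simps) linarith
qed

theorem theorem6:
  fixes \<psi> :: "nat \<Rightarrow> real" and \<tau> :: ereal and s :: real and \<theta> :: "nat \<Rightarrow> real"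
  assumes psi: "\<And>q. 1 \<le> q \<Longrightarrow> 0 < \<psi> q \<and> \<psi> q \<le> 1"
    and tau: "\<tau> = liminf (\<lambda>q. ereal (- ln (\<psi> q) / ln (real q)))"
    and s: "s = real_of_ereal (1 / (1 + \<tau>))"
    and theta: "\<And>q. 1 \<le> q \<Longrightarrow> \<theta> q = real q powr (1 - s) * \<psi> q powr s"
    and tau_gt: "1 < \<tau>"
    and theta_noninc: "antimono_on {1..} \<theta>"
    and diverges: "\<not> summable (\<lambda>k. (\<psi> (Suc k) / real (Suc k)) powr s * ln (real (Suc k)))"
  shows "hausdorff_dim (luroth_L \<psi>) = 1 / (1 + \<tau>)"
proof -
  \<comment> \<open>An infinite \<open>\<tau>\<close> would give \<open>s = 0\<close> and
    \<open>\<theta> q = q\<close>, which increases.\<close>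
  have "\<tau> \<noteq> \<infinity>"
  proof
    assume "\<tau> = \<infinity>"
    then have "s = 0" by (simp add: s)
    then have "\<theta> 1 = 1" "\<theta> 2 = 2" using theta[of 1] theta[of 2] psi[of 1] psi[of 2] by auto
    moreover have "\<theta> 2 \<le> \<theta> 1" using monotone_onD[OF theta_noninc, of 1 2] by simp
    ultimately show False by simp
  qed
  then obtain T where T: "\<tau> = ereal T" "1 < T" using tau_gt by (cases \<tau>) auto
  have dim: "1 / (1 + \<tau>) = ereal (1 / (1 + T))"
    using T by (simp add: one_ereal_def divide_ereal_def inverse_eq_divide)
  then have s_eq: "s = 1 / (1 + T)" by (simp add: s)
  then have s0: "0 < s" using T by simp
  \<comment> \<open>This identity carries the monotonicity of \<open>\<theta>\<close> over to
    \<open>\<psi> q / q\<close>, as \<open>s > 0\<close>.\<close>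
  have powr_s: "(\<psi> q / real q) powr s = \<theta> q / real q" if "1 \<le> q" for q
    using that psi[OF that] by (simp add: theta powr_diff powr_divide)
  have mono: "\<psi> q / real q \<le> \<psi> p / real p" if "1 \<le> p" "p \<le> q" for p q
  proof -
    have "0 \<le> \<theta> q" using theta[of q] that by simp
    have "\<theta> q / real q \<le> \<theta> p / real p"
      using monotone_onD[OF theta_noninc, of p q] that \<open>0 \<le> \<theta> q\<close> by (intro frac_le) auto
    then have "(\<psi> q / real q) powr s \<le> (\<psi> p / real p) powr s"
      using that by (simp add: powr_s)
    moreover have "0 < \<psi> p / real p" "0 < \<psi> q / real q" using psi[of p] psi[of q] that by auto
    ultimately show ?thesis
      using s0 powr_less_mono2[of s "\<psi> p / real p" "\<psi> q / real q"] by force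
  qed
  have upper: "hausdorff_measure t (luroth_L \<psi>) = 0" if t: "1 / (1 + T) < t" for t
  proof -
    have "0 < t" using t T(2) by (smt (verit) divide_pos_pos)
    define r where "r = 1 / t"
    \<comment> \<open>\<open>1 + b\<close> is the midpoint of \<open>1 + T\<close> and
      \<open>1 / t\<close>, which gives both \<open>b < T\<close> and
      \<open>(1 + b) * t > 1\<close>.\<close>
    define b where "b = (T + 1 + r) / 2 - 1"
    have "r < 1 + T" "1 < (1 + T) * t" using t \<open>0 < t\<close> T(2) by (auto simp: r_def field_simps)
    have eq: "(1 + b) * t = ((1 + T) * t + 1) / 2"
      using \<open>0 < t\<close> by (simp add: b_def r_def field_simps)
    have bt: "1 < (1 + b) * t" unfolding eq using \<open>1 < (1 + T) * t\<close> by simp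
    have "b < T" using \<open>r < 1 + T\<close> unfolding b_def by argo
    then have "ereal b < liminf (\<lambda>q. ereal (- ln (\<psi> q) / ln (real q)))"
      using T(1) tau by simp
    then have "\<forall>\<^sub>F q in sequentially. ereal b < ereal (- ln (\<psi> q) / ln (real q))"
      by (rule less_LiminfD)
    moreover have "\<forall>\<^sub>F q in sequentially. 2 \<le> q" by (rule eventually_ge_at_top)
    ultimately have "\<forall>\<^sub>F q in sequentially. \<psi> q \<le> real q powr - b"
    proof eventually_elim
      case (elim q)
      then show ?case using psi[of q] ereal_neg_log_ratio_less_iff(2)[of q \<psi> b] by simp
    qed
    then obtain q\<^sub>0 where "\<And>q. q\<^sub>0 \<le> q \<Longrightarrow> \<psi> q \<le> real q powr - b"
      by (auto simp: eventually_sequentially)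
    from hausdorff_measure_luroth_L_eq_0[OF psi this \<open>0 < t\<close> bt] show ?thesis .
  qed
  have lower: "hausdorff_measure t (luroth_L \<psi>) \<noteq> 0" if t: "0 < t" "t < 1 / (1 + T)" for t
  proof -
    define r where "r = 1 / t"
    \<comment> \<open>The same midpoint; now \<open>1 / t\<close> exceeds \<open>1 + T\<close>, so
      both inequalities are reversed.\<close>
    define b where "b = (T + 1 + r) / 2 - 1"
    have "1 + T < r" "(1 + T) * t < 1" using t T(2) by (auto simp: r_def field_simps)
    have eq: "(1 + b) * t = ((1 + T) * t + 1) / 2"
      using t(1) by (simp add: b_def r_def field_simps)
    have bt: "(1 + b) * t < 1" unfolding eq using \<open>(1 + T) * t < 1\<close> by simp
    have "T < b" using \<open>1 + T < r\<close> unfolding b_def by argo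
    then have "liminf (\<lambda>q. ereal (- ln (\<psi> q) / ln (real q))) < ereal b"
      using T(1) tau by simp
    then have "\<not> (\<forall>\<^sub>F q in sequentially. ereal b \<le> ereal (- ln (\<psi> q) / ln (real q)))"
      using Liminf_bounded[of "ereal b" "\<lambda>q. ereal (- ln (\<psi> q) / ln (real q))" sequentially]
      by (auto simp: not_le[symmetric])
    then have "\<exists>\<^sub>F q in sequentially. ereal (- ln (\<psi> q) / ln (real q)) < ereal b"
      unfolding frequently_def not_less .
    then have "\<exists>\<^sub>F q in sequentially. ereal (- ln (\<psi> q) / ln (real q)) < ereal b \<and> 2 \<le> q"
      by (rule frequently_eventually_frequently) (rule eventually_ge_at_top)
    then have "\<exists>\<^sub>F q in sequentially. real q powr - b \<le> \<psi> q"
    proof (rule frequently_elim1)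
      fix q assume "ereal (- ln (\<psi> q) / ln (real q)) < ereal b \<and> 2 \<le> q"
      then show "real q powr - b \<le> \<psi> q"
        using psi[of q] ereal_neg_log_ratio_less_iff(1)[of q \<psi> b] by simp
    qed
    then show ?thesis
      using hausdorff_measure_luroth_L_neq_0[OF psi mono _ t(1) bt] \<open>T < b\<close> T(2) by simp
  qed
  \<comment> \<open>Nonemptiness, required for the exponent 0, follows from a nonzero measure at any
    one exponent.\<close>
  obtain t where "0 < t" "t < 1 / (1 + T)"
    using dense[of 0 "1 / (1 + T)"] T(2) by auto
  then have "luroth_L \<psi> \<noteq> {}"
    using lower hausdorff_measure_empty by metis
  then have "ereal (1 / (1 + T)) \<le> hausdorff_dim (luroth_L \<psi>)"
    using lower by (intro hausdorff_dim_geI)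
  moreover have "hausdorff_dim (luroth_L \<psi>) \<le> ereal (1 / (1 + T))"
    using upper T(2) by (intro hausdorff_dim_leI) auto
  ultimately show ?thesis unfolding dim by (rule antisym[rotated])
qed

end
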